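(* Let $n\ge1$ and $k\in\mathbb{N}$. Let $H_k$ be the Segal–Bargmann space of holomorphic functions $f$ on $\mathbb{C}^n$ with finite norm for the inner product $$\langle f,g\rangle=\left(\frac{k}{\pi}\right)^n\int_{\mathbb{C}^n}f(z)\overline{g(z)}e^{-k|z|^2}\,dV(z),$$ where $dV$ is Lebesgue measure on $\mathbb{R}^{2n}$. For $p,q\in\mathbb{C}^n$ let $\Theta_p^{(k)}(z)=e^{k z^T\bar p}$ and $\Theta_q^{(k)}(z)=e^{k z^T\bar q}$, let $$w_k=\frac{1}{\|\Theta_p^{(k)}\|^2}\Theta_p^{(k)}\otimes\Theta_p^{(k)}+\frac{1}{\|\Theta_q^{(k)}\|^2}\Theta_q^{(k)}\otimes\Theta_q^{(k)}\in H_k\otimes H_k,\qquad b_k=\frac{1}{\|w_k\|}w_k.$$ Then, as $k\to\infty$ (i.e. for all sufficiently large $k$), the entanglement entropy of $b_k$ satisfies $$E_k(b_k)\ge\frac12\left(1-e^{-k|p-q|^2}\right)^4.$$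
   Context: Notation: for $z,w\in\mathbb{C}^n$, $z^T\bar w=z_1\bar w_1+\dots+z_n\bar w_n$ and $|z|=\sqrt{z^T\bar z}$. $H_k\otimes H_k$ is the Hilbert space tensor product. For a unit vector $b\in H_k\otimes H_k$, with $P_b$ the orthogonal projection onto $\mathbb{C}b$ and $\rho=\mathrm{Tr}_2(P_b)$ the partial trace over the second factor (defined by $\langle x,\rho y\rangle=\sum_i\langle x\otimes e_i,P_b(y\otimes e_i)\rangle$ for an orthonormal basis $\{e_i\}$ of $H_k$), the entanglement entropy is $E_k(b)=-\mathrm{Tr}(\rho\ln\rho)$, with $\rho\ln\rho$ defined by continuous functional calculus (and $0\ln0=0$). *)

theory Defs
  imports "HOL-Analysis.Analysis"
begin

definition sb_holomorphic :: "(complex^'m \<Rightarrow> complex) \<Rightarrow> bool" where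
  "sb_holomorphic f \<longleftrightarrow>
     (\<forall>z. \<exists>L. (f has_derivative L) (at z) \<and> (\<forall>c v. L (c *s v) = c * L v))"

definition sb_space :: "nat \<Rightarrow> (complex^'m \<Rightarrow> complex) set" where
  "sb_space k = {f. sb_holomorphic f \<and>
      integrable lborel (\<lambda>z. (cmod (f z))^2 * exp (- real k * (norm z)^2))}"

definition sb_inner :: "nat \<Rightarrow> (complex^'m \<Rightarrow> complex) \<Rightarrow> (complex^'m \<Rightarrow> complex) \<Rightarrow> complex" where
  "sb_inner k f g = complex_of_real ((real k / pi) ^ CARD('m)) *
      (LINT z|lborel. f z * cnj (g z) * complex_of_real (exp (- real k * (norm z)^2)))"

definition sb_norm :: "nat \<Rightarrow> (complex^'m \<Rightarrow> complex) \<Rightarrow> real" where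
  "sb_norm k f = sqrt (Re (sb_inner k f f))"

text \<open>Orthonormal basis of H_k (indexed by nat; H_k is separable, infinite-dimensional).\<close>
definition sb_onb :: "nat \<Rightarrow> (nat \<Rightarrow> complex^'m \<Rightarrow> complex) \<Rightarrow> bool" where
  "sb_onb k e \<longleftrightarrow> (\<forall>i. e i \<in> sb_space k) \<and>
      (\<forall>i j. sb_inner k (e i) (e j) = (if i = j then 1 else 0)) \<and>
      (\<forall>f\<in>sb_space k. (\<forall>i. sb_inner k f (e i) = 0) \<longrightarrow> f = (\<lambda>_. 0))"

text \<open>H_k(C^n) \<otimes> H_k(C^n) is realized as H_k(C^(2n)), coordinates indexed by 'n + 'n.\<close>
definition vec_fst :: "'a^('n + 'n) \<Rightarrow> 'a^'n" where
  "vec_fst v = (\<chi> i. v $ Inl i)"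

definition vec_snd :: "'a^('n + 'n) \<Rightarrow> 'a^'n" where
  "vec_snd v = (\<chi> i. v $ Inr i)"

definition tensor :: "(complex^'n \<Rightarrow> complex) \<Rightarrow> (complex^'n \<Rightarrow> complex) \<Rightarrow> (complex^('n + 'n) \<Rightarrow> complex)" where
  "tensor f g = (\<lambda>v. f (vec_fst v) * g (vec_snd v))"

definition theta :: "nat \<Rightarrow> complex^'n \<Rightarrow> (complex^'n \<Rightarrow> complex)" where
  "theta k p = (\<lambda>z. exp (of_nat k * (\<Sum>j\<in>UNIV. z $ j * cnj (p $ j))))"

definition w_state :: "nat \<Rightarrow> complex^'n \<Rightarrow> complex^'n \<Rightarrow> (complex^('n + 'n) \<Rightarrow> complex)" where
  "w_state k p q = (\<lambda>v.
      complex_of_real (1 / (sb_norm k (theta k p))^2) * tensor (theta k p) (theta k p) v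
    + complex_of_real (1 / (sb_norm k (theta k q))^2) * tensor (theta k q) (theta k q) v)"

definition b_state :: "nat \<Rightarrow> complex^'n \<Rightarrow> complex^'n \<Rightarrow> (complex^('n + 'n) \<Rightarrow> complex)" where
  "b_state k p q = (\<lambda>v. w_state k p q v / complex_of_real (sb_norm k (w_state k p q)))"

definition proj_line :: "nat \<Rightarrow> (complex^'m \<Rightarrow> complex) \<Rightarrow> (complex^'m \<Rightarrow> complex) \<Rightarrow> (complex^'m \<Rightarrow> complex)" where
  "proj_line k b v = (\<lambda>u. sb_inner k v b * b u)"

text \<open>Sesquilinear form of the partial trace rho = Tr_2(P_b), computed with the ONB e:
  ptrace_form k e b x y = <x, rho y>.\<close>
definition ptrace_form :: "nat \<Rightarrow> (nat \<Rightarrow> complex^'n \<Rightarrow> complex) \<Rightarrow> (complex^('n + 'n) \<Rightarrow> complex)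
    \<Rightarrow> (complex^'n \<Rightarrow> complex) \<Rightarrow> (complex^'n \<Rightarrow> complex) \<Rightarrow> complex" where
  "ptrace_form k e b x y =
     (\<Sum>\<^sub>\<infinity>i. sb_inner k (tensor x (e i)) (proj_line k b (tensor y (e i))))"

text \<open>f is an orthonormal basis of H_k of eigenvectors of the operator rho (given by its
  form <x, rho y>), with real eigenvalues l: rho (f j) = l j * f j.\<close>
definition eigen_onb :: "nat \<Rightarrow> ((complex^'n \<Rightarrow> complex) \<Rightarrow> (complex^'n \<Rightarrow> complex) \<Rightarrow> complex)
    \<Rightarrow> (nat \<Rightarrow> complex^'n \<Rightarrow> complex) \<Rightarrow> (nat \<Rightarrow> real) \<Rightarrow> bool" where
  "eigen_onb k rho f l \<longleftrightarrow> sb_onb k f \<and>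
     (\<forall>j. \<forall>x\<in>sb_space k. rho x (f j) = complex_of_real (l j) * sb_inner k x (f j))"

text \<open>-Tr(rho ln rho) computed in an eigenbasis, with 0 ln 0 = 0.\<close>
definition entropy_of_eigenvalues :: "(nat \<Rightarrow> real) \<Rightarrow> real" where
  "entropy_of_eigenvalues l = (\<Sum>\<^sub>\<infinity>j. (if l j = 0 then 0 else - (l j * ln (l j))))"

end

theory Submission
  imports Defs "HOL-Probability.Probability" "HOL-Complex_Analysis.Complex_Analysis"
begin

text \<open>
  Write \<open>u\<close>, \<open>v\<close> for the normalised coherent states at \<open>p\<close>, \<open>q\<close>, \<open>c = \<langle>u, v\<rangle>\<close> and \<open>s = |c|\<^sup>2\<close>.
  The reproducing property gives \<open>s = exp (-k |p - q|\<^sup>2)\<close>.  The state \<open>u \<otimes> u + v \<otimes> v\<close> has squared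
  norm \<open>N = 2 + 2 Re (c\<^sup>2) \<le> 2 + 2 s\<close>, and its reduced density operator \<open>\<rho>\<close> has rank at most two and
  purity \<open>Tr \<rho>\<^sup>2 = 1 - 2 (1 - s)\<^sup>2 / N\<^sup>2\<close>.  As \<open>- t ln t \<ge> t (1 - t)\<close>, the entropy is at least
  \<open>1 - Tr \<rho>\<^sup>2 \<ge> (1 - s)\<^sup>2 / (2 (1 + s)\<^sup>2) \<ge> (1 - s)\<^sup>4 / 2\<close>.

  Evaluating the partial trace needs Parseval's identity for an arbitrary orthonormal basis, hence
  completeness of the Segal-Bargmann space.  The latter follows from the reproducing property: it turns
  norm convergence into locally uniform convergence of the functions and, by Cauchy's inequality, of
  their derivatives; Fatou's lemma then identifies the pointwise limit as the norm limit.
\<close>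

section \<open>Hilbert spaces of functions\<close>

text \<open>The entropy is read off from an arbitrary eigenbasis, so nothing is known about which
  indices carry nonzero eigenvalues. Trace and purity are therefore obtained by summing over that
  basis with Parseval's identity, and vanishing 3 x 3 determinants show that at most two eigenvalues
  are nonzero. An explicit diagonalisation is used only to prove that an eigenbasis exists.

  The purity formula is a determinant in disguise. In an orthonormal basis of a plane containing u
  and v, let M be the 2 x 2 matrix with columns u and v. The state has coefficient matrix M M^T, and
  |det M|^2 = 1 - s, so the unnormalised reduced operator has determinant |det M|^4 = (1 - s)^2. Two
  eigenvalues with sum N and product (1 - s)^2 have square sum N^2 - 2 (1 - s)^2.

  The spaces are carrier sets with a form, not types: both depend on \<open>k\<close>, and the same
  theory has to serve functions of one point and of a pair of points.\<close>

locale inner_fun_space =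
  fixes V :: "('a \<Rightarrow> complex) set" and ip :: "('a \<Rightarrow> complex) \<Rightarrow> ('a \<Rightarrow> complex) \<Rightarrow> complex"
  assumes zero_mem: "(\<lambda>_. 0) \<in> V"
    and lin_mem: "\<And>f g a b. f \<in> V \<Longrightarrow> g \<in> V \<Longrightarrow> (\<lambda>z. a * f z + b * g z) \<in> V"
    and ip_lin: "\<And>f g h a b. f \<in> V \<Longrightarrow> g \<in> V \<Longrightarrow> h \<in> V \<Longrightarrow>
      ip (\<lambda>z. a * f z + b * g z) h = a * ip f h + b * ip g h"
    and ip_cnj: "\<And>f g. f \<in> V \<Longrightarrow> g \<in> V \<Longrightarrow> cnj (ip f g) = ip g f"
    and ip_nonneg: "\<And>f. f \<in> V \<Longrightarrow> 0 \<le> Re (ip f f)"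
    and ip_definite: "\<And>f. f \<in> V \<Longrightarrow> ip f f = 0 \<Longrightarrow> f = (\<lambda>_. 0)"
begin

lemma scale_mem: "f \<in> V \<Longrightarrow> (\<lambda>z. a * f z) \<in> V"
  using lin_mem[of f f a 0] by simp

lemma diff_mem: "f \<in> V \<Longrightarrow> g \<in> V \<Longrightarrow> (\<lambda>z. f z - g z) \<in> V"
  using lin_mem[of f g 1 "-1"] by simp

lemma ip_scale: "f \<in> V \<Longrightarrow> h \<in> V \<Longrightarrow> ip (\<lambda>z. a * f z) h = a * ip f h"
  using ip_lin[of f f h a 0] by simp

lemma ip_diff: "f \<in> V \<Longrightarrow> g \<in> V \<Longrightarrow> h \<in> V \<Longrightarrow> ip (\<lambda>z. f z - g z) h = ip f h - ip g h"
  using ip_lin[of f g h 1 "-1"] by simp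

lemma ip_lin_right:
  assumes "f \<in> V" "g \<in> V" "h \<in> V"
  shows "ip h (\<lambda>z. a * f z + b * g z) = cnj a * ip h f + cnj b * ip h g"
  using ip_cnj[OF lin_mem[OF assms(1,2)] assms(3), of a b] ip_lin[OF assms, of a b]
  by (simp add: ip_cnj assms)

lemma ip_scale_right: "f \<in> V \<Longrightarrow> h \<in> V \<Longrightarrow> ip h (\<lambda>z. a * f z) = cnj a * ip h f"
  using ip_lin_right[of f f h a 0] by simp

lemma ip_diff_right: "f \<in> V \<Longrightarrow> g \<in> V \<Longrightarrow> h \<in> V \<Longrightarrow> ip h (\<lambda>z. f z - g z) = ip h f - ip h g"
  using ip_lin_right[of f g h 1 "-1"] by simp

lemma ip_zero_left: "h \<in> V \<Longrightarrow> ip (\<lambda>_. 0) h = 0"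
  using ip_scale[of h h 0] by simp

lemma ip_self: "f \<in> V \<Longrightarrow> ip f f = of_real (Re (ip f f))"
  using ip_cnj[of f f] by (metis Reals_cnj_iff of_real_Re)

lemma Cauchy_Schwarz:
  assumes f: "f \<in> V" and g: "g \<in> V"
  shows "(cmod (ip f g))\<^sup>2 \<le> Re (ip f f) * Re (ip g g)"
proof (cases "ip g g = 0")
  case True
  then have "g = (\<lambda>_. 0)" by (rule ip_definite[OF g])
  with ip_zero_left[OF f] ip_cnj[OF g f] have "ip f g = 0" by simp
  then show ?thesis using True by simp
next
  case False
  define G where "G = Re (ip g g)"
  have gg: "ip g g = of_real G" using ip_self[OF g] G_def by simp
  then have "G \<noteq> 0" using False by auto
  then have G0: "G > 0" using ip_nonneg[OF g] unfolding G_def by linarith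
  define c where "c = ip f g"
  have gf: "ip g f = cnj c" using ip_cnj[OF f g] c_def by simp
  \<comment> \<open>Up to the factor \<open>G\<close> this is the component of \<open>f\<close>
    orthogonal to \<open>g\<close>; scaling by \<open>G\<close> avoids a division.\<close>
  define h where "h = (\<lambda>z. of_real G * f z + (- c) * g z)"
  have h: "h \<in> V" unfolding h_def by (rule lin_mem[OF f g])
  have "ip h h = of_real G * ip f h - c * ip g h"
    using ip_lin[OF f g h, of "of_real G" "- c"] unfolding h_def[symmetric] by simp
  also have "ip f h = of_real G * ip f f - cnj c * c"
    unfolding h_def by (subst ip_lin_right[OF f g f]) (simp add: c_def)
  also have "ip g h = 0"
    unfolding h_def by (subst ip_lin_right[OF f g g]) (simp add: gf gg)
  finally have "ip h h = of_real (G * (G * Re (ip f f) - (cmod c)\<^sup>2))"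
    unfolding of_real_mult of_real_diff complex_norm_square ip_self[OF f, symmetric]
    by (simp add: mult.commute[of "cnj c"])
  with ip_nonneg[OF h] have "0 \<le> G * (G * Re (ip f f) - (cmod c)\<^sup>2)" by simp
  with G0 have "0 \<le> G * Re (ip f f) - (cmod c)\<^sup>2" by (simp add: zero_le_mult_iff)
  then show ?thesis by (simp add: c_def G_def mult.commute)
qed

end

locale hilbert_fun_space = inner_fun_space +
  assumes complete: "\<And>X. (\<And>n. X n \<in> V) \<Longrightarrow>
      (\<And>\<epsilon>. 0 < \<epsilon> \<Longrightarrow> \<exists>N. \<forall>m\<ge>N. \<forall>n\<ge>N. Re (ip (\<lambda>z. X m z - X n z) (\<lambda>z. X m z - X n z)) < \<epsilon>) \<Longrightarrow>
      \<exists>g\<in>V. (\<lambda>n. Re (ip (\<lambda>z. X n z - g z) (\<lambda>z. X n z - g z))) \<longlonglongrightarrow> 0"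
begin

definition orthonormal_basis :: "(nat \<Rightarrow> 'a \<Rightarrow> complex) \<Rightarrow> bool" where
  "orthonormal_basis e \<longleftrightarrow> (\<forall>i. e i \<in> V) \<and> (\<forall>i j. ip (e i) (e j) = (if i = j then 1 else 0)) \<and>
     (\<forall>f\<in>V. (\<forall>i. ip f (e i) = 0) \<longrightarrow> f = (\<lambda>_. 0))"

lemma sum_mem: "(\<And>i. e i \<in> V) \<Longrightarrow> (\<lambda>z. \<Sum>i<n::nat. c i * e i z) \<in> V"
proof (induction n)
  case (Suc n)
  then have "(\<lambda>z. 1 * (\<Sum>i<n. c i * e i z) + c n * e n z) \<in> V" by (intro lin_mem) auto
  then show ?case by simp
qed (simp add: zero_mem)

lemma ip_sum:
  assumes "\<And>i. e i \<in> V" "h \<in> V"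
  shows "ip (\<lambda>z. \<Sum>i<n::nat. c i * e i z) h = (\<Sum>i<n. c i * ip (e i) h)"
proof (induction n)
  case (Suc n)
  have "ip (\<lambda>z. 1 * (\<Sum>i<n. c i * e i z) + c n * e n z) h
      = 1 * ip (\<lambda>z. \<Sum>i<n. c i * e i z) h + c n * ip (e n) h"
    using assms by (intro ip_lin sum_mem) auto
  then show ?case using Suc by simp
qed (simp add: ip_zero_left assms)

section \<open>Bessel's inequality and Parseval's identity\<close>

text \<open>Bessel's inequality bounds the increasing sums \<open>T n\<close>, so the partial
  expansions \<open>S n\<close> are Cauchy. Their limit has the same coefficients as
  \<open>a\<close>, and maximality of the orthonormal system forces it to be
  \<open>a\<close>.\<close>

lemma Parseval_sums:
  assumes e: "orthonormal_basis e" and a: "a \<in> V"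
  shows "summable (\<lambda>i. (cmod (ip a (e i)))\<^sup>2)"
    and "b \<in> V \<Longrightarrow> (\<lambda>i. ip a (e i) * ip (e i) b) sums ip a b"
proof -
  have eV: "e i \<in> V" and eo: "ip (e i) (e j) = (if i = j then 1 else 0)" for i j
    using e by (auto simp: orthonormal_basis_def)
  define c where "c i = ip a (e i)" for i
  define S where "S n = (\<lambda>z. \<Sum>i<n. c i * e i z)" for n
  have SV: "S n \<in> V" for n unfolding S_def by (rule sum_mem[OF eV])
  have ipS: "ip (S n) h = (\<Sum>i<n. c i * ip (e i) h)" if "h \<in> V" for n h
    unfolding S_def by (rule ip_sum[OF eV that])
  have Se: "ip (S n) (e j) = (if j < n then c j else 0)" for n j
    by (simp add: ipS[OF eV] eo if_distrib[of "\<lambda>x. _ * x"] cong: if_cong)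
  have eS: "ip (e j) (S n) = (if j < n then cnj (c j) else 0)" for n j
    using ip_cnj[OF SV[of n] eV[of j]] Se[of n j] by (auto split: if_splits)
  have ea: "ip (e j) a = cnj (c j)" for j
    using ip_cnj[OF a eV[of j]] c_def by simp
  define T where "T n = (\<Sum>i<n. (cmod (c i))\<^sup>2)" for n
  have cc: "x * cnj x = of_real ((cmod x)\<^sup>2)" for x by (rule complex_norm_square[symmetric])
  \<comment> \<open>Mixed products see only the common initial segment, so all distances between
    partial sums become differences of values of \<open>T\<close>.\<close>
  have SS: "ip (S m) (S n) = of_real (T (min m n))" for m n
  proof -
    have "ip (S m) (S n) = (\<Sum>i<m. if i < n then of_real ((cmod (c i))\<^sup>2) else 0)"
      by (simp add: ipS[OF SV] eS if_distrib[of "\<lambda>x. _ * x"] cc cong: if_cong)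
    also have "\<dots> = (\<Sum>i\<in>{..<m} \<inter> {i. i < n}. of_real ((cmod (c i))\<^sup>2))"
      by (simp add: sum.inter_restrict del: of_real_power)
    also have "{..<m} \<inter> {i. i < n} = {..<min m n}" by auto
    finally show ?thesis by (simp add: T_def)
  qed
  have Sa: "ip (S n) a = of_real (T n)" for n
    by (simp add: ipS[OF a] ea cc T_def)
  have aS: "ip a (S n) = of_real (T n)" for n
    using ip_cnj[OF SV[of n] a] by (simp add: Sa)
  have "0 \<le> Re (ip a a) - T n" for n
    using ip_nonneg[OF diff_mem[OF a SV[of n]]]
    by (simp add: ip_diff[OF a SV diff_mem[OF a SV]] ip_diff_right[OF a SV a] ip_diff_right[OF a SV SV] SS Sa aS)
  then have Tb: "T n \<le> Re (ip a a)" for n by (simp add: algebra_simps)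
  show sm: "summable (\<lambda>i. (cmod (ip a (e i)))\<^sup>2)"
    by (rule bounded_imp_summable[of _ "Re (ip a a)"])
      (use Tb[of "Suc _"] in \<open>auto simp: T_def c_def lessThan_Suc_atMost\<close>)
  then have "convergent T" unfolding T_def c_def by (simp add: summable_iff_convergent)
  then have CT: "Cauchy T" by (simp add: Cauchy_convergent_iff)
  have dS: "Re (ip (\<lambda>z. S m z - S n z) (\<lambda>z. S m z - S n z)) = T m + T n - 2 * T (min m n)" for m n
    by (simp add: ip_diff[OF SV SV diff_mem[OF SV SV]] ip_diff_right[OF SV SV SV] SS min.commute)
  have "\<exists>g\<in>V. (\<lambda>n. Re (ip (\<lambda>z. S n z - g z) (\<lambda>z. S n z - g z))) \<longlonglongrightarrow> 0"
  proof (rule complete[OF SV])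
    fix \<epsilon> :: real assume "0 < \<epsilon>"
    with CT obtain N where N: "\<forall>m\<ge>N. \<forall>n\<ge>N. dist (T m) (T n) < \<epsilon>" unfolding Cauchy_def by blast
    have "Re (ip (\<lambda>z. S m z - S n z) (\<lambda>z. S m z - S n z)) < \<epsilon>" if "m \<ge> N" "n \<ge> N" for m n
      using N[rule_format, OF that] unfolding dS by (cases "m \<le> n") (auto simp: dist_real_def min_def)
    then show "\<exists>N. \<forall>m\<ge>N. \<forall>n\<ge>N. Re (ip (\<lambda>z. S m z - S n z) (\<lambda>z. S m z - S n z)) < \<epsilon>" by blast
  qed
  then obtain g where g: "g \<in> V"
    and lim: "(\<lambda>n. Re (ip (\<lambda>z. S n z - g z) (\<lambda>z. S n z - g z))) \<longlonglongrightarrow> 0" by blast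
  \<comment> \<open>Cauchy-Schwarz turns norm convergence into weak convergence, which identifies
    the coefficients of \<open>g\<close> and finally yields the sum itself.\<close>
  have ipSg: "(\<lambda>n. ip (S n) h) \<longlonglongrightarrow> ip g h" if h: "h \<in> V" for h
  proof -
    have "(\<lambda>n. (cmod (ip (\<lambda>z. S n z - g z) h))\<^sup>2) \<longlonglongrightarrow> 0"
    proof (rule tendsto_sandwich[OF _ _ tendsto_const])
      show "\<forall>\<^sub>F n in sequentially. (cmod (ip (\<lambda>z. S n z - g z) h))\<^sup>2
          \<le> Re (ip (\<lambda>z. S n z - g z) (\<lambda>z. S n z - g z)) * Re (ip h h)"
        using Cauchy_Schwarz[OF diff_mem[OF SV g] h] by simp
      show "(\<lambda>n. Re (ip (\<lambda>z. S n z - g z) (\<lambda>z. S n z - g z)) * Re (ip h h)) \<longlonglongrightarrow> 0"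
        using tendsto_mult_right[OF lim] by simp
    qed simp
    then have "(\<lambda>n. sqrt ((cmod (ip (\<lambda>z. S n z - g z) h))\<^sup>2)) \<longlonglongrightarrow> sqrt 0" by (rule tendsto_real_sqrt)
    then have "(\<lambda>n. ip (S n) h - ip g h) \<longlonglongrightarrow> 0"
      by (simp add: ip_diff[OF SV g h] tendsto_norm_zero_iff)
    then show ?thesis by (simp add: LIM_zero_iff)
  qed
  have "ip g (e i) = c i" for i
  proof (rule LIMSEQ_unique[OF ipSg[OF eV]])
    show "(\<lambda>n. ip (S n) (e i)) \<longlonglongrightarrow> c i"
      by (rule tendsto_eventually) (auto simp: Se eventually_sequentially intro!: exI[of _ "Suc i"])
  qed
  then have "ip (\<lambda>z. a z - g z) (e i) = 0" for i
    by (simp add: ip_diff[OF a g eV] c_def)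
  then have "(\<lambda>z. a z - g z) = (\<lambda>_. 0)"
    using e diff_mem[OF a g] by (auto simp: orthonormal_basis_def)
  then have "g = a" by (auto simp: fun_eq_iff)
  then show "(\<lambda>i. ip a (e i) * ip (e i) b) sums ip a b" if "b \<in> V"
    using ipSg[OF that] by (simp add: sums_def ipS[OF that] c_def)
qed

text \<open>The partial trace is an unordered infinite sum, so convergence of the partial sums is
  not enough. Absolute summability follows by comparing each product with the sum of the two
  squares.\<close>

lemma Parseval:
  assumes e: "orthonormal_basis e" and a: "a \<in> V" and b: "b \<in> V"
  shows "((\<lambda>i. ip a (e i) * ip (e i) b) has_sum ip a b) UNIV"
proof (rule norm_summable_imp_has_sum[OF _ Parseval_sums(2)[OF e a b]])
  have eV: "e i \<in> V" for i using e by (auto simp: orthonormal_basis_def)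
  show "summable (\<lambda>i. norm (ip a (e i) * ip (e i) b))"
  proof (rule summable_comparison_test)
    show "summable (\<lambda>i. (cmod (ip a (e i)))\<^sup>2 + (cmod (ip b (e i)))\<^sup>2)"
      by (intro summable_add Parseval_sums(1)[OF e] a b)
    have "cmod (ip a (e i)) * cmod (ip (e i) b) \<le> (cmod (ip a (e i)))\<^sup>2 + (cmod (ip b (e i)))\<^sup>2" for i
    proof -
      have "cmod (ip (e i) b) = cmod (ip b (e i))"
        using ip_cnj[OF b eV[of i]] by (metis complex_mod_cnj)
      moreover have "2 * (cmod (ip a (e i)) * cmod (ip b (e i))) \<le> (cmod (ip a (e i)))\<^sup>2 + (cmod (ip b (e i)))\<^sup>2"
        using sum_squares_bound[of "cmod (ip a (e i))" "cmod (ip b (e i))"] by simp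
      moreover have "0 \<le> cmod (ip a (e i)) * cmod (ip b (e i))" by simp
      ultimately show ?thesis by (simp only: mult_2)
    qed
    then show "\<exists>N. \<forall>n\<ge>N. norm (norm (ip a (e n) * ip (e n) b)) \<le> (cmod (ip a (e n)))\<^sup>2 + (cmod (ip b (e n)))\<^sup>2"
      by (simp add: norm_mult)
  qed
qed

text \<open>The Householder reflection exchanging \<open>e i\<close> with a unimodular multiple of \<open>a\<close> fixes
  everything orthogonal to both.\<close>
lemma orthonormal_basis_exchange:
  assumes e: "orthonormal_basis e" and a: "a \<in> V" "ip a a = 1"
    and S: "\<And>j. j \<in> S \<Longrightarrow> ip (e j) a = 0" "i \<notin> S"
  obtains f where "orthonormal_basis f" "f i = a" "\<And>j. j \<in> S \<Longrightarrow> f j = e j"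
proof -
  have eV: "e i \<in> V" and eo: "ip (e i) (e j) = (if i = j then 1 else 0)"
    and et: "f \<in> V \<Longrightarrow> (\<And>i. ip f (e i) = 0) \<Longrightarrow> f = (\<lambda>_. 0)" for i j f
    using e by (auto simp: orthonormal_basis_def)
  \<comment> \<open>Reflecting along \<open>e i - a'\<close> carries \<open>e i\<close> to
    \<open>a'\<close> only if their inner product is real; the phase arranges this. The value 1
    covers the case where \<open>sgn\<close> would give 0.\<close>
  define \<omega> where "\<omega> = (if ip (e i) a = 0 then 1 else sgn (ip (e i) a))"
  have \<omega>: "\<omega> * cnj \<omega> = 1"
    by (simp add: \<omega>_def complex_norm_square[symmetric] norm_sgn)
  then have \<omega>0: "\<omega> \<noteq> 0" by auto
  define t where "t = cmod (ip (e i) a)"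
  define a' where "a' = (\<lambda>z. \<omega> * a z)"
  have a'V: "a' \<in> V" unfolding a'_def by (rule scale_mem[OF a(1)])
  have aa': "ip a' a' = 1"
    using \<omega> by (simp add: a'_def ip_scale[OF a(1) scale_mem[OF a(1)]] ip_scale_right[OF a(1) a(1)] a)
  have ea': "ip (e i) a' = of_real t"
  proof (cases "ip (e i) a = 0")
    case False
    have "cnj (sgn (ip (e i) a)) * ip (e i) a = of_real ((cmod (ip (e i) a))\<^sup>2) / of_real t"
      unfolding complex_norm_square by (simp add: sgn_eq t_def mult.commute)
    with False show ?thesis
      by (simp add: a'_def ip_scale_right[OF a(1) eV] \<omega>_def t_def power2_eq_square)
  qed (simp add: a'_def ip_scale_right[OF a(1) eV] t_def)
  have ae': "ip a' (e i) = of_real t" using ip_cnj[OF eV a'V, of i] by (simp add: ea')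
  have Sa': "ip (e j) a' = 0" if "j \<in> S" for j
    using S(1)[OF that] by (simp add: a'_def ip_scale_right[OF a(1) eV])
  have "\<exists>f. orthonormal_basis f \<and> f i = a' \<and> (\<forall>j\<in>S. f j = e j)"
  proof (cases "t = 1")
    \<comment> \<open>Equality in Cauchy-Schwarz: \<open>a'\<close> already is \<open>e i\<close>,
      and the reflection vector would be zero.\<close>
    case True
    have "ip (\<lambda>z. e i z - a' z) (\<lambda>z. e i z - a' z) = 0"
      by (simp add: ip_diff[OF eV a'V diff_mem[OF eV a'V]] ip_diff_right[OF eV a'V eV]
          ip_diff_right[OF eV a'V a'V] eo ea' ae' aa' True)
    from ip_definite[OF diff_mem[OF eV a'V] this] have "e i = a'" by (auto simp: fun_eq_iff)
    then show ?thesis using e by auto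
  next
    case False
    define d where "d = (\<lambda>z. e i z - a' z)"
    have dV: "d \<in> V" unfolding d_def by (rule diff_mem[OF eV a'V])
    \<comment> \<open>The squared norm of \<open>d\<close>, as \<open>dd\<close> confirms;
      \<open>H\<close> below is the reflection in the hyperplane orthogonal to
      \<open>d\<close>.\<close>
    define D :: complex where "D = of_real (2 - 2 * t)"
    have D0: "D \<noteq> 0" and Dc: "cnj D = D"
      using False unfolding D_def of_real_eq_0_iff by auto
    have ed: "ip (e i) d = of_real (1 - t)"
      by (simp add: d_def ip_diff_right[OF eV a'V eV] eo ea')
    have dd: "ip d d = D"
    proof -
      have "ip d d = ip (e i) d - ip a' d" by (subst (1) d_def) (rule ip_diff[OF eV a'V dV])
      also have "ip a' d = of_real (t - 1)"
        by (simp add: d_def ip_diff_right[OF eV a'V a'V] ae' aa')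
      finally show ?thesis by (simp add: ed D_def)
    qed
    define H where "H x = (\<lambda>z. 1 * x z + (- 2 * ip x d / D) * d z)" for x
    have HV: "H x \<in> V" if "x \<in> V" for x unfolding H_def by (rule lin_mem[OF that dV])
    have ipH: "ip (H x) y = ip x y - 2 * ip x d * ip d y / D" if "x \<in> V" "y \<in> V" for x y
      unfolding H_def by (subst ip_lin[OF that(1) dV that(2)]) simp
    have Hip: "ip x (H y) = ip x y - 2 * ip x d * ip d y / D" if "x \<in> V" "y \<in> V" for x y
      unfolding H_def by (subst ip_lin_right[OF that(2) dV that(1)])
        (simp add: ip_cnj[OF that(2) dV] Dc)
    have HH: "ip (H x) (H y) = ip x y" if "x \<in> V" "y \<in> V" for x y
    proof -
      have "ip d (H y) = - ip d y" using D0 by (simp add: Hip[OF dV that(2)] dd)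
      then show ?thesis by (simp add: ipH[OF that(1) HV[OF that(2)]] Hip[OF that])
    qed
    have HHx: "H (H x) = x" if "x \<in> V" for x
    proof -
      have "ip (H x) d = - ip x d" using D0 by (simp add: ipH[OF that dV] dd)
      then show ?thesis by (auto simp: H_def fun_eq_iff)
    qed
    show ?thesis
    proof (intro exI[of _ "\<lambda>j. H (e j)"] conjI ballI)
      show "orthonormal_basis (\<lambda>j. H (e j))"
        unfolding orthonormal_basis_def
      proof (intro conjI allI ballI impI)
        fix f assume f: "f \<in> V" and z: "\<forall>i. ip f (H (e i)) = 0"
        have "ip (H f) (e j) = 0" for j
          using z[rule_format, of j] by (simp add: ipH[OF f eV] Hip[OF f eV])
        then have "H f = (\<lambda>_. 0)" by (rule et[OF HV[OF f]])
        moreover have "H (\<lambda>_. 0) = (\<lambda>_. 0)" by (simp add: H_def ip_zero_left[OF dV])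
        ultimately show "f = (\<lambda>_. 0)" using HHx[OF f] by simp
      qed (simp_all add: HV eV HH eo)
      have "2 * ip (e i) d / D = 1" using D0 by (simp add: ed D_def divide_simps)
      then show "H (e i) = a'" by (simp add: H_def d_def[THEN fun_cong])
      fix j assume j: "j \<in> S"
      then have "j \<noteq> i" using S by auto
      then have "ip (e j) d = 0" using Sa'[OF j] by (simp add: d_def ip_diff_right[OF eV a'V eV] eo)
      then show "H (e j) = e j" by (simp add: H_def)
    qed
  qed
  then obtain f where f: "orthonormal_basis f" "f i = a'" "\<And>j. j \<in> S \<Longrightarrow> f j = e j" by blast
  \<comment> \<open>Undoes the phase: replacing one member by a unimodular multiple of itself leaves
    an orthonormal basis.\<close>
  define g where "g = f(i := a)"
  have fV: "f i \<in> V" and fo: "ip (f i) (f j) = (if i = j then 1 else 0)"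
    and ft: "f' \<in> V \<Longrightarrow> (\<And>i. ip f' (f i) = 0) \<Longrightarrow> f' = (\<lambda>_. 0)" for i j f'
    using f(1) by (auto simp: orthonormal_basis_def)
  have aw: "ip h a' = cnj \<omega> * ip h a" "ip a' h = \<omega> * ip a h" if "h \<in> V" for h
    using that by (auto simp: a'_def ip_scale_right a ip_scale)
  have "orthonormal_basis g"
    unfolding orthonormal_basis_def
  proof (intro conjI allI ballI impI)
    show "g j \<in> V" for j using fV a by (simp add: g_def)
    show "ip (g j) (g l) = (if j = l then 1 else 0)" for j l
      using fo[of j l] aw[OF fV[of j]] aw[OF fV[of l]] \<omega>0 f(2) a
      by (auto simp: g_def split: if_splits)
    fix h assume h: "h \<in> V" and z: "\<forall>i. ip h (g i) = 0"
    have "ip h (f j) = 0" for j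
      using z[rule_format, of j] aw[OF h] f(2) by (auto simp: g_def split: if_splits)
    then show "h = (\<lambda>_. 0)" by (rule ft[OF h])
  qed
  moreover have "g i = a" "\<And>j. j \<in> S \<Longrightarrow> g j = e j"
    using f S(2) by (auto simp: g_def)
  ultimately show thesis using that by blast
qed

end

section \<open>Partial traces of rank two\<close>

text \<open>Jacobi's rotation for the real symmetric matrix with diagonal A, D and off-diagonal
  entry B: the second equation says that the rotated off-diagonal entry vanishes. Half the polar
  angle of the point ((A - D) / 2, B) works by the double-angle formulas.\<close>

lemma rotation_diagonalises:
  fixes A B D :: real
  obtains C S where "C\<^sup>2 + S\<^sup>2 = 1" "C * S * (D - A) + (C\<^sup>2 - S\<^sup>2) * B = 0"
proof -
  obtain \<rho> t where *: "Complex ((A - D) / 2) B = rcis \<rho> t"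
    using rcis_Ex by blast
  have 1: "A - D = 2 * \<rho> * cos t" "B = \<rho> * sin t"
    using arg_cong[OF *, of Re] arg_cong[OF *, of Im] by auto
  have "cos (t/2) * sin (t/2) * (D - A) + ((cos (t/2))\<^sup>2 - (sin (t/2))\<^sup>2) * B = 0"
  proof -
    have "sin t = 2 * sin (t/2) * cos (t/2)" "cos t = (cos (t/2))\<^sup>2 - (sin (t/2))\<^sup>2"
      using sin_double[of "t/2"] cos_double[of "t/2"] by auto
    with 1 show ?thesis by algebra
  qed
  then show thesis using that[of "cos (t/2)" "sin (t/2)"] by simp
qed

context hilbert_fun_space begin

text \<open>For unit vectors \<open>u\<close>, \<open>v\<close> this is the sesquilinear form of the partial trace of the
  (unnormalised) rank-one operator on \<open>u \<otimes> u + v \<otimes> v\<close>.\<close>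
definition pair_form :: "('a \<Rightarrow> complex) \<Rightarrow> ('a \<Rightarrow> complex) \<Rightarrow> ('a \<Rightarrow> complex) \<Rightarrow> ('a \<Rightarrow> complex) \<Rightarrow> complex" where
  "pair_form u v x y = ip x u * ip u y + ip x v * ip v y + ip v u * ip x u * ip v y + ip u v * ip x v * ip u y"

context
  fixes u v
  assumes u: "u \<in> V" and v: "v \<in> V"
begin

lemma pair_form_lin:
  assumes "f \<in> V" "g \<in> V"
  shows "pair_form u v (\<lambda>z. a * f z + b * g z) y = a * pair_form u v f y + b * pair_form u v g y"
  by (simp add: pair_form_def ip_lin[OF assms u] ip_lin[OF assms v] algebra_simps)

lemma pair_form_lin_right:
  assumes "f \<in> V" "g \<in> V"
  shows "pair_form u v y (\<lambda>z. a * f z + b * g z) = cnj a * pair_form u v y f + cnj b * pair_form u v y g"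
  by (simp add: pair_form_def ip_lin_right[OF assms u] ip_lin_right[OF assms v] algebra_simps)

lemma pair_form_cnj: "x \<in> V \<Longrightarrow> y \<in> V \<Longrightarrow> cnj (pair_form u v x y) = pair_form u v y x"
  by (simp add: pair_form_def ip_cnj u v algebra_simps)

lemma pair_form_self: "x \<in> V \<Longrightarrow> pair_form u v x x = of_real (Re (pair_form u v x x))"
  using pair_form_cnj[of x x] by (metis Reals_cnj_iff of_real_Re)

text \<open>The form sees \<open>x\<close> only through its products with \<open>u\<close> and
  \<open>v\<close>, so \<open>x\<close> may be replaced by its projection onto the plane of
  \<open>a\<close> and \<open>b\<close>.\<close>

lemma pair_form_expand:
  assumes "\<And>h. h \<in> {u, v} \<Longrightarrow> ip x h = ip x a * ip a h + ip x b * ip b h"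
  shows "pair_form u v x y = ip x a * pair_form u v a y + ip x b * pair_form u v b y"
  by (simp add: pair_form_def assms algebra_simps)

text \<open>Gram-Schmidt, with the expansion stated only against \<open>u\<close> and
  \<open>v\<close>, which is all that \<open>pair_form\<close> sees. The basis \<open>e\<close>
  supplies a second vector when \<open>u\<close> and \<open>v\<close> are dependent.\<close>

lemma orthonormal_pair_span:
  assumes e: "orthonormal_basis e" and uu: "ip u u = 1"
  obtains a b where "a \<in> V" "b \<in> V" "ip a a = 1" "ip b b = 1" "ip a b = 0"
    "\<And>x h. x \<in> V \<Longrightarrow> h \<in> {u, v} \<Longrightarrow> ip x h = ip x a * ip a h + ip x b * ip b h"
proof -
  define h where "h = (\<lambda>z. 1 * v z + (- ip v u) * u z)"
  have hV: "h \<in> V" unfolding h_def by (rule lin_mem[OF v u])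
  have uh: "ip u h = 0"
    unfolding h_def by (subst ip_lin_right[OF v u u]) (simp add: ip_cnj u v uu)
  have v_eq: "v = (\<lambda>z. 1 * h z + ip v u * u z)" by (simp add: h_def fun_eq_iff)
  have xv: "ip x v = ip x h + ip u v * ip x u" if "x \<in> V" for x
    using ip_lin_right[OF hV u that, of 1 "ip v u"] unfolding v_eq[symmetric] by (simp add: ip_cnj u v)
  show thesis
  proof (cases "ip h h = 0")
    case True
    then have h0: "h = (\<lambda>_. 0)" by (rule ip_definite[OF hV])
    then have xh: "ip x h = 0" if "x \<in> V" for x
      using ip_cnj[OF hV that] ip_zero_left[OF that] by simp
    \<comment> \<open>Here \<open>v\<close> is a multiple of \<open>u\<close>, as for p = q. Once
      \<open>u\<close> sits in slot 0 of a basis, slot 1 holds a unit vector orthogonal to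
      it.\<close>
    obtain f where f: "orthonormal_basis f" "f 0 = u"
      using orthonormal_basis_exchange[OF e u uu, of "{}" 0] by auto
    have fo: "f i \<in> V" "ip (f i) (f j) = (if i = j then 1 else 0)" for i j
      using f(1) by (auto simp: orthonormal_basis_def)
    have fu: "ip (f 1) u = 0" using fo(2)[of 1 0] f(2) by simp
    show thesis
    proof (rule that[of u "f 1"])
      show "ip u (f 1) = 0" using fo(2)[of 0 1] f(2) by simp
      show "ip x k = ip x u * ip u k + ip x (f 1) * ip (f 1) k" if "x \<in> V" "k \<in> {u, v}" for x k
        using that fu by (auto simp: uu xv xh fo)
    qed (use fo u uu in auto)
  next
    case False
    define n where "n = sqrt (Re (ip h h))"
    have hh: "ip h h = of_real (n\<^sup>2)" and n0: "n \<noteq> 0"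
      using ip_self[OF hV] ip_nonneg[OF hV] False unfolding n_def by auto
    define b where "b = (\<lambda>z. of_real (1 / n) * h z)"
    have bV: "b \<in> V" unfolding b_def by (rule scale_mem[OF hV])
    have xb: "ip x b = ip x h / n" if "x \<in> V" for x
      unfolding b_def by (subst ip_scale_right[OF hV that]) simp
    have bx: "ip b x = ip h x / n" if "x \<in> V" for x
      unfolding b_def by (subst ip_scale[OF hV that]) simp
    have hu: "ip h u = 0" using ip_cnj[OF u hV] uh by simp
    show thesis
    proof (rule that[OF u bV uu])
      show "ip b b = 1" using n0 by (simp add: xb[OF bV] bx[OF hV] hh power2_eq_square)
      show "ip u b = 0" by (simp add: xb[OF u] uh)
      have "ip b v = n" using n0 by (simp add: bx[OF v] xv[OF hV] hh hu power2_eq_square)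
      moreover have "ip b u = 0" by (simp add: bx[OF u] hu)
      ultimately show "ip x k = ip x u * ip u k + ip x b * ip b k" if "x \<in> V" "k \<in> {u, v}" for x k
        using that n0 by (auto simp: xb xv uu)
    qed
  qed
qed

text \<open>On the plane of \<open>a\<close> and \<open>b\<close> the form is a Hermitian 2 x 2
  matrix, and the orthogonal complement lies in its kernel. Diagonalising this block and completing
  to a basis is enough.\<close>

lemma pair_form_eigenbasis:
  assumes e: "orthonormal_basis e" and uu: "ip u u = 1"
  obtains f l where "orthonormal_basis f"
    "\<And>j x. x \<in> V \<Longrightarrow> pair_form u v x (f j) = of_real (l j) * ip x (f j)"
proof -
  obtain a b where aV: "a \<in> V" and bV: "b \<in> V" and aa: "ip a a = 1" and bb: "ip b b = 1" and ab: "ip a b = 0"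
    and span: "\<And>x h. x \<in> V \<Longrightarrow> h \<in> {u, v} \<Longrightarrow> ip x h = ip x a * ip a h + ip x b * ip b h"
    using orthonormal_pair_span[OF e uu] by blast
  have ba: "ip b a = 0" using ip_cnj[OF aV bV] ab by simp
  define r where "r = pair_form u v"
  \<comment> \<open>A phase on \<open>b\<close> makes the off-diagonal entry a nonnegative real, so
    that a real rotation can diagonalise the block.\<close>
  define \<omega> where "\<omega> = (if r a b = 0 then 1 else sgn (r a b))"
  have \<omega>: "\<omega> * cnj \<omega> = 1"
    by (simp add: \<omega>_def complex_norm_square[symmetric] norm_sgn)
  have rab: "cnj \<omega> * r a b = of_real (cmod (r a b))"
  proof (cases "r a b = 0")
    case False
    have "cnj (sgn (r a b)) * r a b = of_real ((cmod (r a b))\<^sup>2) / of_real (cmod (r a b))"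
      unfolding complex_norm_square by (simp add: sgn_eq mult.commute)
    with False show ?thesis by (simp add: \<omega>_def power2_eq_square)
  qed simp
  have rba: "\<omega> * r b a = of_real (cmod (r a b))"
    using arg_cong[OF rab, of cnj] pair_form_cnj[OF aV bV] by (simp add: r_def)
  obtain C S :: real where CS: "C\<^sup>2 + S\<^sup>2 = 1"
    "C * S * (Re (r b b) - Re (r a a)) + (C\<^sup>2 - S\<^sup>2) * cmod (r a b) = 0"
    using rotation_diagonalises by blast
  define f0 where "f0 = (\<lambda>z. of_real C * a z + (of_real S * \<omega>) * b z)"
  define f1 where "f1 = (\<lambda>z. of_real (- S) * a z + (of_real C * \<omega>) * b z)"
  have f0V: "f0 \<in> V" and f1V: "f1 \<in> V" unfolding f0_def f1_def by (intro lin_mem aV bV)+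
  have xf0: "ip x f0 = of_real C * ip x a + of_real S * cnj \<omega> * ip x b" if "x \<in> V" for x
    unfolding f0_def by (subst ip_lin_right[OF aV bV that]) simp
  have xf1: "ip x f1 = - of_real S * ip x a + of_real C * cnj \<omega> * ip x b" if "x \<in> V" for x
    unfolding f1_def by (subst ip_lin_right[OF aV bV that]) simp
  have f0x: "ip f0 x = of_real C * ip a x + of_real S * \<omega> * ip b x" if "x \<in> V" for x
    unfolding f0_def by (subst ip_lin[OF aV bV that]) simp
  have f1x: "ip f1 x = - of_real S * ip a x + of_real C * \<omega> * ip b x" if "x \<in> V" for x
    unfolding f1_def by (subst ip_lin[OF aV bV that]) simp
  have CSc: "(of_real C)\<^sup>2 + (of_real S)\<^sup>2 = (1::complex)"
    using arg_cong[OF CS(1), of complex_of_real] by simp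
  have f00: "ip f0 f0 = 1"
    using CSc \<omega> by (simp add: f0x[OF f0V] xf0[OF aV] xf0[OF bV] aa bb ab ba) algebra
  have f11: "ip f1 f1 = 1"
    using CSc \<omega> by (simp add: f1x[OF f1V] xf1[OF aV] xf1[OF bV] aa bb ab ba) algebra
  have f01: "ip f0 f1 = 0"
    using \<omega> by (simp add: f0x[OF f1V] xf1[OF aV] xf1[OF bV] aa bb ab ba)
  \<comment> \<open>The pair \<open>f0\<close>, \<open>f1\<close> is a unitary image of
    \<open>a\<close>, \<open>b\<close>, hence resolves the same plane.\<close>
  have span': "ip x h = ip x f0 * ip f0 h + ip x f1 * ip f1 h" if x: "x \<in> V" and h: "h \<in> {u, v}" for x h
  proof -
    have "h \<in> V" using h u v by auto
    then show ?thesis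
      unfolding span[OF x h] xf0[OF x] xf1[OF x] f0x[OF \<open>h \<in> V\<close>] f1x[OF \<open>h \<in> V\<close>]
      using CSc \<omega> by algebra
  qed
  have r01: "r f0 f1 = 0"
  proof -
    have raa: "r a a = of_real (Re (r a a))" and rbb: "r b b = of_real (Re (r b b))"
      unfolding r_def by (rule pair_form_self[OF aV], rule pair_form_self[OF bV])
    have "r f0 f1 = of_real C * (- of_real S * r a a + of_real C * (cnj \<omega> * r a b))
       + of_real S * (- of_real S * (\<omega> * r b a) + of_real C * (\<omega> * cnj \<omega>) * r b b)"
      unfolding r_def f0_def f1_def pair_form_lin[OF aV bV] pair_form_lin_right[OF aV bV]
      by (simp add: algebra_simps)
    also have "\<dots> = of_real (C * S * (Re (r b b) - Re (r a a)) + (C\<^sup>2 - S\<^sup>2) * cmod (r a b))"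
      unfolding rab rba \<omega> by (subst raa, subst rbb) (simp add: algebra_simps power2_eq_square)
    finally show ?thesis using CS(2) by simp
  qed
  have r10: "r f1 f0 = 0" using pair_form_cnj[OF f0V f1V] r01 by (simp add: r_def)
  obtain g where g: "orthonormal_basis g" "g 0 = f0"
    using orthonormal_basis_exchange[OF e f0V f00, of "{}" 0] by auto
  \<comment> \<open>The second exchange acts on slot 1 and keeps slot 0, since \<open>f1\<close> is
    orthogonal to \<open>f0\<close>.\<close>
  obtain f where f: "orthonormal_basis f" "f 1 = f1" "f 0 = f0"
  proof (rule orthonormal_basis_exchange[OF g(1) f1V f11, of "{0}" 1])
    show "ip (g j) f1 = 0" if "j \<in> {0}" for j using that g(2) f01 by simp
  qed (use g(2) in auto)
  define l where "l j = Re (r (f j) (f j))" for j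
  have fo: "f i \<in> V" "ip (f i) (f j) = (if i = j then 1 else 0)" for i j
    using f(1) by (auto simp: orthonormal_basis_def)
  have "r x (f j) = of_real (l j) * ip x (f j)" if x: "x \<in> V" for x j
  proof -
    have ex: "r x y = ip x f0 * r f0 y + ip x f1 * r f1 y" for y
      unfolding r_def by (rule pair_form_expand) (rule span'[OF x])
    have rl: "r (f j) (f j) = of_real (l j)"
      unfolding l_def r_def by (rule pair_form_self[OF fo(1)])
    consider "j = 0" | "j = 1" | "j > 1" by linarith
    then show ?thesis
    proof cases
      case 1 then show ?thesis using ex[of f0] r10 rl f by simp
    next
      case 2 then show ?thesis using ex[of f1] r01 rl f by simp
    next
      \<comment> \<open>All further members are orthogonal to the plane, so the form vanishes on
        them in either argument and their eigenvalue is 0.\<close>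
      case 3
      then have z: "ip (f j) f0 = 0" "ip (f j) f1 = 0" using fo(2)[of j 0] fo(2)[of j 1] f by auto
      have y0: "r y (f j) = 0" if "y \<in> V" for y
      proof -
        have "r (f j) y = ip (f j) f0 * r f0 y + ip (f j) f1 * r f1 y"
          unfolding r_def by (rule pair_form_expand) (rule span'[OF fo(1)])
        then show ?thesis using z pair_form_cnj[OF fo(1)[of j] that] by (simp add: r_def)
      qed
      show ?thesis using y0[OF x] y0[OF fo(1)] rl by simp
    qed
  qed
  with f(1) show thesis unfolding r_def by (rule that)
qed

text \<open>The two cross terms carry the overlap of \<open>u\<close> and \<open>v\<close> as a
  factor; its modulus is at most 1, so the diagonal terms dominate.\<close>

lemma pair_form_nonneg:
  assumes uu: "ip u u = 1" "ip v v = 1" and x: "x \<in> V"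
  shows "0 \<le> Re (pair_form u v x x)"
proof -
  define U W c where "U = ip x u" and "W = ip x v" and "c = ip u v"
  have [simp]: "ip u x = cnj U" "ip v x = cnj W" "ip v u = cnj c"
    using ip_cnj u v x by (auto simp: U_def W_def c_def)
  have "cmod c ^ 2 \<le> 1" using Cauchy_Schwarz[OF u v] uu by (simp add: c_def)
  then have c1: "cmod c \<le> 1" by (simp add: power_le_one_iff abs_square_le_1)
  have "pair_form u v x x = U * cnj U + W * cnj W + (c * W * cnj U + cnj (c * W * cnj U))"
    by (simp add: pair_form_def flip: U_def W_def c_def)
  then have "Re (pair_form u v x x) = (cmod U)\<^sup>2 + (cmod W)\<^sup>2 + 2 * Re (c * W * cnj U)"
    by (simp only: complex_norm_square[symmetric] complex_add_cnj) simp
  moreover have "\<bar>Re (c * W * cnj U)\<bar> \<le> cmod U * cmod W"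
  proof -
    have "\<bar>Re (c * W * cnj U)\<bar> \<le> cmod c * (cmod U * cmod W)"
      using abs_Re_le_cmod[of "c * W * cnj U"] by (simp add: norm_mult mult_ac)
    also have "\<dots> \<le> cmod U * cmod W" using c1 by (simp add: mult_left_le_one_le)
    finally show ?thesis .
  qed
  moreover have "2 * (cmod U * cmod W) \<le> (cmod U)\<^sup>2 + (cmod W)\<^sup>2"
    using sum_squares_bound[of "cmod U" "cmod W"] by simp
  ultimately show ?thesis by linarith
qed

text \<open>The form is a sum of two products of a factor in \<open>x\<close> and a factor in
  \<open>y\<close>, so every 3 x 3 determinant of its values vanishes.\<close>

lemma pair_form_rank_two:
  "pair_form u v x1 y1 * (pair_form u v x2 y2 * pair_form u v x3 y3 - pair_form u v x2 y3 * pair_form u v x3 y2)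
   - pair_form u v x1 y2 * (pair_form u v x2 y1 * pair_form u v x3 y3 - pair_form u v x2 y3 * pair_form u v x3 y1)
   + pair_form u v x1 y3 * (pair_form u v x2 y1 * pair_form u v x3 y2 - pair_form u v x2 y2 * pair_form u v x3 y1) = 0"
proof -
  define P Q where "P y = ip u y + ip v u * ip v y" and "Q y = ip v y + ip u v * ip u y" for y
  have *: "pair_form u v x y = ip x u * P y + ip x v * Q y" for x y
    by (simp add: pair_form_def P_def Q_def algebra_simps)
  show ?thesis unfolding * by algebra
qed

text \<open>The form is not normalised, so the eigenvalues sum to the squared norm \<open>N\<close>
  of the unnormalised state instead of 1.\<close>

lemma pair_form_eigenvalues:
  fixes l :: "nat \<Rightarrow> real"
  assumes uu: "ip u u = 1" "ip v v = 1" and f: "orthonormal_basis f"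
    and eig: "\<And>j x. x \<in> V \<Longrightarrow> pair_form u v x (f j) = of_real (l j) * ip x (f j)"
  defines "N \<equiv> 2 + 2 * Re ((ip u v)\<^sup>2)"
  shows "0 \<le> l j" and "finite {j. l j \<noteq> 0}" and "(l has_sum N) UNIV"
    and "((\<lambda>j. (l j)\<^sup>2) has_sum N\<^sup>2 - 2 * (1 - (cmod (ip u v))\<^sup>2)\<^sup>2) UNIV"
proof -
  have fo: "f i \<in> V" "ip (f i) (f j) = (if i = j then 1 else 0)" for i j
    using f by (auto simp: orthonormal_basis_def)
  have rf: "pair_form u v (f i) (f j) = (if i = j then of_real (l j) else 0)" for i j
    using eig[OF fo(1)[of i], of j] by (simp add: fo)
  show "0 \<le> l j" using pair_form_nonneg[OF uu fo(1)[of j]] by (simp add: rf)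
  \<comment> \<open>On three distinct eigenvectors the determinant is diagonal, that is, the product
    of their eigenvalues.\<close>
  have *: False if "i \<noteq> j" "j \<noteq> k" "i \<noteq> k" "l i \<noteq> 0" "l j \<noteq> 0" "l k \<noteq> 0" for i j k
    using pair_form_rank_two[of "f i" "f i" "f j" "f j" "f k" "f k"] that by (simp add: rf)
  show "finite {j. l j \<noteq> 0}"
  proof (rule ccontr)
    assume "infinite {j. l j \<noteq> 0}"
    then obtain T where "T \<subseteq> {j. l j \<noteq> 0}" "finite T" "card T = 3"
      using infinite_arbitrarily_large by blast
    then obtain i j k where "T = {i, j, k}" "i \<noteq> j" "j \<noteq> k" "i \<noteq> k"
      unfolding card_3_iff by blast
    with * \<open>T \<subseteq> _\<close> show False by blast
  qed
  define c where "c = ip u v"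
  have vu: "ip v u = cnj c" using ip_cnj[OF u v] c_def by simp
  have Nc: "complex_of_real N = 2 + c\<^sup>2 + (cnj c)\<^sup>2"
    using complex_add_cnj[of "c\<^sup>2"] unfolding N_def c_def by simp
  have sc: "complex_of_real ((cmod (ip u v))\<^sup>2) = c * cnj c" unfolding c_def by (rule complex_norm_square)
  have P: "((\<lambda>j. ip a (f j) * ip (f j) b) has_sum ip a b) UNIV" if "a \<in> {u,v}" "b \<in> {u,v}" for a b
    using that u v by (intro Parseval[OF f]) auto
  note Ps = P[of u u, simplified] P[of v v, simplified] P[of u v, simplified] P[of v u, simplified]
  have "((\<lambda>j. ip u (f j) * ip (f j) u + ip v (f j) * ip (f j) v + cnj c * (ip v (f j) * ip (f j) u)
      + c * (ip u (f j) * ip (f j) v)) has_sum ip u u + ip v v + cnj c * ip v u + c * ip u v) UNIV"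
    by (intro has_sum_add has_sum_cmult_right Ps)
  also have "(\<lambda>j. ip u (f j) * ip (f j) u + ip v (f j) * ip (f j) v + cnj c * (ip v (f j) * ip (f j) u)
      + c * (ip u (f j) * ip (f j) v)) = (\<lambda>j. complex_of_real (l j))"
  proof
    fix j show "ip u (f j) * ip (f j) u + ip v (f j) * ip (f j) v + cnj c * (ip v (f j) * ip (f j) u)
      + c * (ip u (f j) * ip (f j) v) = complex_of_real (l j)"
      using rf[of j j] by (simp add: pair_form_def vu mult_ac flip: c_def)
  qed
  also have "ip u u + ip v v + cnj c * ip v u + c * ip u v = of_real N"
    by (simp add: uu vu Nc power2_eq_square flip: c_def)
  finally show "(l has_sum N) UNIV" by (simp only: has_sum_of_real_iff)
  \<comment> \<open>Entries of the 2 x 2 matrix by which the operator acts on the pair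
    \<open>ip u (f j)\<close>, \<open>ip v (f j)\<close>, read off from the eigenvalue equation at
    \<open>x = u\<close> and \<open>x = v\<close>.\<close>
  define k1 k2 where "k1 = 1 + c\<^sup>2" and "k2 = c + cnj c"
  have lu: "of_real (l j) * ip u (f j) = k1 * ip u (f j) + k2 * ip v (f j)" for j
    using eig[OF u, of j] by (simp add: pair_form_def uu vu k1_def k2_def power2_eq_square algebra_simps flip: c_def)
  have lv: "of_real (l j) * ip v (f j) = k2 * ip u (f j) + cnj k1 * ip v (f j)" for j
    using eig[OF v, of j] by (simp add: pair_form_def uu vu k1_def k2_def power2_eq_square algebra_simps flip: c_def)
  \<comment> \<open>One factor \<open>l j\<close> is the diagonal value of the form, the other is
    absorbed by \<open>lu\<close> and \<open>lv\<close>. What remains is linear in products that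
    Parseval's identity can sum.\<close>
  have l2: "complex_of_real ((l j)\<^sup>2) =
      (k1 + cnj c * k2) * (ip u (f j) * ip (f j) u) + (k2 + cnj c * cnj k1) * (ip v (f j) * ip (f j) u)
    + (k2 + c * k1) * (ip u (f j) * ip (f j) v) + (cnj k1 + c * k2) * (ip v (f j) * ip (f j) v)" for j
  proof -
    have "complex_of_real ((l j)\<^sup>2) = of_real (l j) * pair_form u v (f j) (f j)"
      by (simp add: rf power2_eq_square)
    also have "\<dots> = ip (f j) u * (of_real (l j) * ip u (f j)) + ip (f j) v * (of_real (l j) * ip v (f j))
       + cnj c * ip (f j) u * (of_real (l j) * ip v (f j)) + c * ip (f j) v * (of_real (l j) * ip u (f j))"
      by (simp add: pair_form_def vu algebra_simps flip: c_def)
    also have "\<dots> = (k1 + cnj c * k2) * (ip u (f j) * ip (f j) u) + (k2 + cnj c * cnj k1) * (ip v (f j) * ip (f j) u)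
    + (k2 + c * k1) * (ip u (f j) * ip (f j) v) + (cnj k1 + c * k2) * (ip v (f j) * ip (f j) v)"
      unfolding lu lv by (simp add: algebra_simps)
    finally show ?thesis .
  qed
  have "((\<lambda>j. complex_of_real ((l j)\<^sup>2)) has_sum
      (k1 + cnj c * k2) * ip u u + (k2 + cnj c * cnj k1) * ip v u
    + (k2 + c * k1) * ip u v + (cnj k1 + c * k2) * ip v v) UNIV"
    unfolding l2 by (intro has_sum_add has_sum_cmult_right Ps)
  also have "(k1 + cnj c * k2) * ip u u + (k2 + cnj c * cnj k1) * ip v u
    + (k2 + c * k1) * ip u v + (cnj k1 + c * k2) * ip v v
    = of_real (N\<^sup>2 - 2 * (1 - (cmod (ip u v))\<^sup>2)\<^sup>2)"
    unfolding of_real_diff of_real_mult of_real_power[of N] Nc of_real_power[of "1 - (cmod (ip u v))\<^sup>2"] sc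
    by (simp add: uu vu k1_def k2_def flip: c_def) algebra
  finally show "((\<lambda>j. (l j)\<^sup>2) has_sum N\<^sup>2 - 2 * (1 - (cmod (ip u v))\<^sup>2)\<^sup>2) UNIV"
    by (simp only: has_sum_of_real_iff)
qed

end

end

text \<open>Finite support reduces all three infinite sums to one finite index set. In particular
  the entropy sum converges and does not take the default value 0 of a divergent one.\<close>

lemma entropy_ge_linear_entropy:
  fixes l :: "nat \<Rightarrow> real"
  assumes nonneg: "\<And>j. 0 \<le> l j" and fin: "finite {j. l j \<noteq> 0}"
    and sum1: "(l has_sum 1) UNIV" and sum2: "((\<lambda>j. (l j)\<^sup>2) has_sum q) UNIV"
  shows "1 - q \<le> entropy_of_eigenvalues l"
proof -
  let ?J = "{j. l j \<noteq> 0}"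
  have red: "infsum g UNIV = sum g ?J" if "\<And>j. l j = 0 \<Longrightarrow> g j = 0" for g :: "nat \<Rightarrow> real"
    using fin that by (subst infsum_cong_neutral[where T = ?J and g = g]) auto
  have "1 - q = sum l ?J - (\<Sum>j\<in>?J. (l j)\<^sup>2)"
    using red[of l] red[of "\<lambda>j. (l j)\<^sup>2"] infsumI[OF sum1] infsumI[OF sum2] by simp
  also have "\<dots> = (\<Sum>j\<in>?J. l j - (l j)\<^sup>2)" by (simp add: sum_subtractf)
  also have "\<dots> \<le> (\<Sum>j\<in>?J. if l j = 0 then 0 else - (l j * ln (l j)))"
  proof (rule sum_mono)
    fix j assume "j \<in> ?J"
    then have pos: "l j > 0" using nonneg[of j] by auto
    have "l j * ln (l j) \<le> l j * (l j - 1)"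
      using pos ln_le_minus_one[OF pos] by (intro mult_left_mono) auto
    then show "l j - (l j)\<^sup>2 \<le> (if l j = 0 then 0 else - (l j * ln (l j)))"
      using pos by (simp add: power2_eq_square algebra_simps)
  qed
  also have "\<dots> = entropy_of_eigenvalues l"
    unfolding entropy_of_eigenvalues_def by (rule red[symmetric]) simp
  finally show ?thesis .
qed

section \<open>Lebesgue measure on complex vector spaces\<close>

lemma linear_borel_measurable:
  fixes f :: "'a::euclidean_space \<Rightarrow> 'b::euclidean_space"
  shows "linear f \<Longrightarrow> f \<in> borel_measurable borel"
  by (intro borel_measurable_continuous_onI linear_continuous_on) (simp add: linear_conv_bounded_linear)

text \<open>A linear map matching up the coordinate axes pulls boxes back to boxes with the same
  side lengths. It is applied to the identification of \<open>real^2\<close> with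
  \<open>complex\<close> and to \<open>vec_join\<close>.\<close>

lemma distr_lborel_Basis_bij:
  fixes \<phi> :: "'a::euclidean_space \<Rightarrow> 'b::euclidean_space"
  assumes lin: "linear \<phi>" and bij: "bij_betw \<phi> Basis Basis"
  shows "distr lborel borel \<phi> = lborel"
proof (rule lborel_eqI[symmetric])
  have meas [measurable]: "\<phi> \<in> borel_measurable borel"
    by (rule linear_borel_measurable[OF lin])
  have ip: "\<phi> x \<bullet> \<phi> a = x \<bullet> a" if a: "a \<in> Basis" for x a
  proof -
    have "\<phi> x = \<phi> (\<Sum>b\<in>Basis. (x \<bullet> b) *\<^sub>R b)" by (simp add: euclidean_representation)
    also have "\<dots> = (\<Sum>b\<in>Basis. (x \<bullet> b) *\<^sub>R \<phi> b)"
      by (simp add: linear_sum[OF lin] linear_cmul[OF lin])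
    finally have "\<phi> x \<bullet> \<phi> a = (\<Sum>b\<in>Basis. (x \<bullet> b) * (\<phi> b \<bullet> \<phi> a))" by (simp add: inner_sum_left)
    also have "\<dots> = (\<Sum>b\<in>Basis. (x \<bullet> b) * (if b = a then 1 else 0))"
    proof (rule sum.cong[OF refl])
      fix b :: 'a assume b: "b \<in> Basis"
      then have "\<phi> b \<in> Basis" "\<phi> a \<in> Basis" "\<phi> b = \<phi> a \<longleftrightarrow> b = a"
        using bij a by (auto simp: bij_betw_def inj_on_eq_iff)
      then show "(x \<bullet> b) * (\<phi> b \<bullet> \<phi> a) = (x \<bullet> b) * (if b = a then 1 else 0)"
        by (simp add: inner_Basis)
    qed
    also have "\<dots> = x \<bullet> a" using a by (simp add: if_distrib cong: if_cong)
    finally show ?thesis .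
  qed
  fix l u :: 'b assume le: "\<And>b. b \<in> Basis \<Longrightarrow> l \<bullet> b \<le> u \<bullet> b"
  \<comment> \<open>The transpose of \<open>\<phi>\<close>; it sends the corners of a box to the
    corners of its preimage.\<close>
  define adj where "adj y = (\<Sum>a\<in>Basis. (y \<bullet> \<phi> a) *\<^sub>R a)" for y
  have adj: "adj y \<bullet> a = y \<bullet> \<phi> a" if "a \<in> Basis" for y a
    using that by (simp add: adj_def inner_sum_left inner_Basis if_distrib cong: if_cong)
  have \<phi>B: "\<phi> a \<in> Basis" if "a \<in> Basis" for a using bij that by (auto simp: bij_betw_def)
  have "\<phi> -` box l u = box (adj l) (adj u)"
  proof -
    have "(\<forall>i\<in>Basis. l \<bullet> i < \<phi> x \<bullet> i \<and> \<phi> x \<bullet> i < u \<bullet> i) \<longleftrightarrow>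
        (\<forall>a\<in>Basis. l \<bullet> \<phi> a < \<phi> x \<bullet> \<phi> a \<and> \<phi> x \<bullet> \<phi> a < u \<bullet> \<phi> a)" for x
      using bij unfolding bij_betw_def by (metis (no_types, lifting) image_iff)
    then show ?thesis by (auto simp: mem_box ip adj)
  qed
  then have "emeasure (distr lborel borel \<phi>) (box l u) = emeasure lborel (box (adj l) (adj u))"
    by (simp add: emeasure_distr)
  also have "\<dots> = (\<Prod>a\<in>Basis. (adj u - adj l) \<bullet> a)"
    by (rule emeasure_lborel_box) (simp add: adj le \<phi>B)
  also have "(\<Prod>a\<in>Basis. (adj u - adj l) \<bullet> a) = (\<Prod>a\<in>Basis. (u - l) \<bullet> \<phi> a)"
    by (intro prod.cong) (auto simp: inner_diff_left adj)
  also have "\<dots> = (\<Prod>b\<in>Basis. (u - l) \<bullet> b)" by (rule prod.reindex_bij_betw[OF bij])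
  finally show "emeasure (distr lborel borel \<phi>) (box l u) = ennreal (\<Prod>b\<in>Basis. (u - l) \<bullet> b)" .
qed simp

lemma distr_lborel_orthogonal:
  fixes T :: "real^'n::{finite,wellorder} \<Rightarrow> real^'n::_"
  assumes T: "orthogonal_transformation T"
  shows "distr lborel borel T = lborel"
proof (rule lborel_eqI[symmetric])
  have meas [measurable]: "T \<in> borel_measurable borel"
    by (rule linear_borel_measurable[OF orthogonal_transformation_linear[OF T]])
  fix l u :: "real^'n::{finite,wellorder}" assume le: "\<And>b. b \<in> Basis \<Longrightarrow> l \<bullet> b \<le> u \<bullet> b"
  have im: "T -` box l u = inv T ` box l u"
    by (rule bij_vimage_eq_inv_image[OF orthogonal_transformation_bij[OF T]])
  have iT: "orthogonal_transformation (inv T)" by (rule orthogonal_transformation_inv[OF T])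
  have bl: "box l u \<in> lmeasurable" by simp
  have fm: "T -` box l u \<in> lmeasurable" unfolding im by (rule measurable_orthogonal_image[OF iT bl])
  have b: "T -` box l u \<in> sets lborel" using measurable_sets[OF meas, of "box l u"] by simp
  have "emeasure (distr lborel borel T) (box l u) = emeasure lborel (T -` box l u)"
    by (simp add: emeasure_distr)
  also have "\<dots> = emeasure lebesgue (T -` box l u)" using b by simp
  also have "\<dots> = measure lebesgue (T -` box l u)" using fm by (simp add: emeasure_eq_measure2)
  also have "measure lebesgue (T -` box l u) = measure lebesgue (box l u)"
    unfolding im by (rule measure_orthogonal_image[OF iT bl])
  also have "\<dots> = (\<Prod>b\<in>Basis. (u - l) \<bullet> b)" using le by (simp add: measure_lborel_box_eq)
  finally show "emeasure (distr lborel borel T) (box l u) = ennreal (\<Prod>b\<in>Basis. (u - l) \<bullet> b)" .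
qed simp

text \<open>Read through \<open>real^2\<close>, multiplication by a unimodular number is an
  orthogonal transformation, and the identification itself preserves Lebesgue measure.\<close>

lemma distr_lborel_complex_rotation:
  fixes w :: complex
  assumes w: "cmod w = 1"
  shows "distr lborel borel (\<lambda>z. w * z) = lborel"
proof -
  define \<phi> :: "real^2 \<Rightarrow> complex" where "\<phi> x = Complex (x $ 1) (x $ 2)" for x
  define \<psi> :: "complex \<Rightarrow> real^2" where "\<psi> z = vector [Re z, Im z]" for z
  have \<phi>\<psi>: "\<phi> (\<psi> z) = z" for z by (simp add: \<phi>_def \<psi>_def)
  have lin: "linear \<phi>" by (rule linearI) (auto simp: \<phi>_def complex_eq_iff)
  have lin': "linear \<psi>" by (rule linearI) (auto simp: \<psi>_def vec_eq_iff forall_2)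
  have B: "(Basis :: (real^2) set) = {axis 1 1, axis 2 1}" by (auto simp: Basis_vec_def UNIV_2)
  moreover have "\<phi> (axis 1 1) = 1" "\<phi> (axis 2 1) = \<i>" by (auto simp: \<phi>_def complex_eq_iff axis_def)
  ultimately have bij: "bij_betw \<phi> Basis Basis"
    unfolding B by (auto simp: bij_betw_def Basis_complex_def inj_on_def axis_eq_axis complex_eq_iff)
  have d: "distr lborel borel \<phi> = lborel" by (rule distr_lborel_Basis_bij[OF lin bij])
  have lw: "linear (\<lambda>z. w * z)" by (rule linearI) (auto simp: algebra_simps)
  define T where "T x = \<psi> (w * \<phi> x)" for x
  have lT: "linear T" unfolding T_def
    using linear_compose[OF linear_compose[OF lin lw] lin'] by (simp add: o_def)
  have n\<psi>: "norm (\<psi> z) = cmod z" for z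
    by (simp add: \<psi>_def norm_vec_def L2_set_def cmod_def sum_2)
  have n\<phi>: "cmod (\<phi> x) = norm x" for x
    by (simp add: \<phi>_def norm_vec_def L2_set_def cmod_def sum_2)
  have oT: "orthogonal_transformation T"
    unfolding orthogonal_transformation using lT by (simp add: T_def n\<psi> n\<phi> norm_mult w)
  have "distr lborel borel (\<lambda>z. w * z) = distr (distr lborel borel \<phi>) borel (\<lambda>z. w * z)"
    by (simp only: d)
  also have "\<dots> = distr lborel borel ((\<lambda>z. w * z) \<circ> \<phi>)"
    using linear_borel_measurable[OF lin] linear_borel_measurable[OF lw] by (intro distr_distr) auto
  also have "(\<lambda>z. w * z) \<circ> \<phi> = \<phi> \<circ> T" by (auto simp: T_def \<phi>\<psi>)
  also have "distr lborel borel (\<phi> \<circ> T) = distr (distr lborel borel T) borel \<phi>"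
    using linear_borel_measurable[OF lin] linear_borel_measurable[OF lT] by (intro distr_distr[symmetric]) auto
  also have "\<dots> = lborel" by (simp add: distr_lborel_orthogonal[OF oT] d)
  finally show ?thesis .
qed

lemma mem_box_vec: "x \<in> box l u \<longleftrightarrow> (\<forall>i. x $ i \<in> box (l $ i) (u $ i))"
  for x :: "'a::euclidean_space^'m"
  by (auto simp: mem_box Basis_vec_def inner_axis)

text \<open>With \<open>T\<close> the identity this exhibits Lebesgue measure as a product measure.
  With \<open>T\<close> a rotation it reduces a common phase on all coordinates to the case of a
  single one.\<close>

lemma distr_PiM_vec_lborel:
  fixes T :: "complex \<Rightarrow> complex"
  assumes T[measurable]: "T \<in> borel_measurable borel" and inv: "distr lborel borel T = lborel"
  shows "distr (Pi\<^sub>M UNIV (\<lambda>_::'m::finite. lborel)) borel (\<lambda>f. \<chi> i. T (f i)) = (lborel :: (complex^'m) measure)"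
proof (rule lborel_eqI[symmetric])
  interpret product_sigma_finite "\<lambda>_::'m. lborel :: complex measure" ..
  have meas [measurable]: "(\<lambda>f. \<chi> i. T (f i)) \<in> borel_measurable (Pi\<^sub>M UNIV (\<lambda>_::'m. lborel))"
  proof (subst borel_measurable_euclidean_space, intro ballI)
    fix b :: "complex^'m" assume "b \<in> Basis"
    then obtain i c where b: "b = axis i c" by (auto simp: Basis_vec_def)
    show "(\<lambda>f. (\<chi> i. T (f i)) \<bullet> b) \<in> borel_measurable (Pi\<^sub>M UNIV (\<lambda>_::'m. lborel))"
      unfolding b inner_axis by simp
  qed
  fix l u :: "complex^'m" assume le: "\<And>b. b \<in> Basis \<Longrightarrow> l \<bullet> b \<le> u \<bullet> b"
  have le': "l $ i \<bullet> c \<le> u $ i \<bullet> c" if "c \<in> Basis" for i c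
    using le[of "axis i c"] that by (auto simp: inner_axis Basis_vec_def)
  have "emeasure (distr (Pi\<^sub>M UNIV (\<lambda>_::'m. lborel)) borel (\<lambda>f. \<chi> i. T (f i))) (box l u)
      = emeasure (Pi\<^sub>M UNIV (\<lambda>_::'m. lborel)) (\<Pi>\<^sub>E i\<in>UNIV. T -` box (l $ i) (u $ i))"
    by (subst emeasure_distr) (auto intro!: arg_cong[where f = "emeasure _"] simp: mem_box_vec space_PiM PiE_def Pi_def)
  also have "\<dots> = (\<Prod>i\<in>UNIV. emeasure lborel (T -` box (l $ i) (u $ i)))"
    using measurable_sets[OF T] by (intro emeasure_PiM) auto
  also have "\<dots> = (\<Prod>i\<in>UNIV. ennreal (\<Prod>c\<in>Basis. (u $ i - l $ i) \<bullet> c))"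
  proof (rule prod.cong[OF refl])
    fix i
    have "emeasure lborel (T -` box (l $ i) (u $ i)) = emeasure (distr lborel borel T) (box (l $ i) (u $ i))"
      by (simp add: emeasure_distr)
    also have "\<dots> = ennreal (\<Prod>c\<in>Basis. (u $ i - l $ i) \<bullet> c)"
      unfolding inv by (rule emeasure_lborel_box) (rule le')
    finally show "emeasure lborel (T -` box (l $ i) (u $ i)) = ennreal (\<Prod>c\<in>Basis. (u $ i - l $ i) \<bullet> c)" .
  qed
  also have "\<dots> = ennreal (\<Prod>i\<in>UNIV. \<Prod>c\<in>Basis. (u $ i - l $ i) \<bullet> c)"
    by (intro prod_ennreal prod_nonneg) (auto simp: inner_diff_left le')
  also have "(\<Prod>i\<in>UNIV. \<Prod>c\<in>Basis. (u $ i - l $ i) \<bullet> c) = (\<Prod>(i, c)\<in>UNIV \<times> Basis. (u - l) \<bullet> axis i c)"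
    by (simp add: prod.cartesian_product inner_axis)
  also have "\<dots> = (\<Prod>b\<in>Basis. (u - l) \<bullet> b)"
  proof -
    have "bij_betw (\<lambda>(i, c). axis i c :: complex^'m) (UNIV \<times> Basis) Basis"
      by (auto simp: bij_betw_def inj_on_def axis_eq_axis Basis_vec_def image_iff nonzero_Basis)
    from prod.reindex_bij_betw[OF this, of "\<lambda>b. (u - l) \<bullet> b"] show ?thesis by (simp add: case_prod_beta)
  qed
  finally show "emeasure (distr (Pi\<^sub>M UNIV (\<lambda>_::'m. lborel)) borel (\<lambda>f. \<chi> i. T (f i))) (box l u)
     = ennreal (\<Prod>b\<in>Basis. (u - l) \<bullet> b)" .
qed simp

lemma continuous_on_vec_scale [continuous_intros]:
  fixes g :: "'a::topological_space \<Rightarrow> complex^'m"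
  shows "continuous_on S h \<Longrightarrow> continuous_on S g \<Longrightarrow> continuous_on S (\<lambda>x. h x *s g x)"
  unfolding vector_scalar_mult_def by (intro continuous_intros)

lemma distr_lborel_vec_rotation:
  fixes w :: complex
  assumes w: "cmod w = 1"
  shows "distr lborel borel (\<lambda>z. w *s z) = (lborel :: (complex^'m) measure)"
proof -
  let ?P = "Pi\<^sub>M UNIV (\<lambda>_::'m. lborel :: complex measure)"
  have id: "distr ?P borel (\<lambda>f. \<chi> i. f i) = lborel"
    using distr_PiM_vec_lborel[of "\<lambda>x. x"] by (simp add: distr_id2)
  have rot: "distr ?P borel (\<lambda>f. \<chi> i. w * f i) = lborel"
    by (rule distr_PiM_vec_lborel[OF _ distr_lborel_complex_rotation[OF w]]) simp
  have m: "(\<lambda>f. \<chi> i. f i) \<in> borel_measurable ?P"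
  proof (subst borel_measurable_euclidean_space, intro ballI)
    fix b :: "complex^'m" assume "b \<in> Basis"
    then obtain i c where b: "b = axis i c" by (auto simp: Basis_vec_def)
    show "(\<lambda>f. (\<chi> i. f i) \<bullet> b) \<in> borel_measurable ?P"
      unfolding b inner_axis by simp
  qed
  have "distr lborel borel (\<lambda>z. w *s z) = distr (distr ?P borel (\<lambda>f. \<chi> i. f i)) borel (\<lambda>z. w *s z)"
    by (simp only: id)
  also have "\<dots> = distr ?P borel ((\<lambda>z. w *s z) \<circ> (\<lambda>f. \<chi> i. f i))"
    using m by (intro distr_distr borel_measurable_continuous_onI continuous_intros) auto
  also have "(\<lambda>z. w *s z) \<circ> (\<lambda>f. \<chi> i. f i) = (\<lambda>f. \<chi> i. w * f i)"
    by (auto simp: vector_scalar_mult_def)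
  finally show ?thesis using rot by simp
qed

section \<open>Gaussian integrals and product integrands\<close>

lemma has_bochner_integral_exp_neg_square:
  assumes k: "k > 0"
  shows "has_bochner_integral lborel (\<lambda>x::real. exp (- k * x\<^sup>2)) (sqrt (pi / k))"
proof -
  \<comment> \<open>The standard deviation for which the normal density has exponent
    \<open>- k * x\<^sup>2\<close>.\<close>
  define \<sigma> where "\<sigma> = sqrt (1 / (2 * k))"
  have \<sigma>: "\<sigma> > 0" "\<sigma>\<^sup>2 = 1 / (2 * k)" using k by (auto simp: \<sigma>_def)
  have "has_bochner_integral lborel (\<lambda>x. sqrt (pi / k) * normal_density 0 \<sigma> x) (sqrt (pi / k) * 1)"
    using integrable_normal_density[OF \<sigma>(1)] integral_normal_density[OF \<sigma>(1)]
    by (intro has_bochner_integral_mult_right) (simp add: has_bochner_integral_iff)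
  moreover have "sqrt (pi / k) * normal_density 0 \<sigma> x = exp (- k * x\<^sup>2)" for x
    using k by (simp add: normal_density_def \<sigma>(2) real_sqrt_divide)
  ultimately show ?thesis by simp
qed

text \<open>The weight is a product over the real coordinates. There are two of these per complex
  coordinate, so the one-dimensional square roots pair up.\<close>

lemma has_bochner_integral_gaussian:
  assumes k: "k > 0"
  shows "has_bochner_integral lborel (\<lambda>z::complex^'m. exp (- k * (norm z)\<^sup>2)) ((pi / k) ^ CARD('m))"
proof (rule has_bochner_integral_nn_integral)
  have "(\<integral>\<^sup>+z. ennreal (exp (- k * (norm (z::complex^'m))\<^sup>2)) \<partial>lborel)
      = (\<integral>\<^sup>+z. (\<Prod>b\<in>Basis. ennreal (exp (- k * ((z::complex^'m) \<bullet> b)\<^sup>2))) \<partial>lborel)"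
  proof (rule nn_integral_cong)
    fix z :: "complex^'m"
    have "exp (- k * (norm z)\<^sup>2) = (\<Prod>b\<in>Basis. exp (- k * (z \<bullet> b)\<^sup>2))"
      by (subst exp_sum[symmetric]) (simp_all add: sum_distrib_left[symmetric] sum_negf
           euclidean_inner[of z z] power2_norm_eq_inner flip: power2_eq_square)
    then show "ennreal (exp (- k * (norm z)\<^sup>2)) = (\<Prod>b\<in>Basis. ennreal (exp (- k * (z \<bullet> b)\<^sup>2)))"
      by (simp add: prod_ennreal)
  qed
  also have "\<dots> = (\<Prod>b\<in>(Basis :: (complex^'m) set). \<integral>\<^sup>+x. ennreal (exp (- k * x\<^sup>2)) \<partial>lborel)"
    by (rule nn_integral_lborel_prod) auto
  also have "(\<integral>\<^sup>+x. ennreal (exp (- k * x\<^sup>2)) \<partial>lborel) = ennreal (sqrt (pi / k))"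
    using has_bochner_integral_exp_neg_square[OF k]
    by (subst nn_integral_eq_integral) (auto simp: has_bochner_integral_iff)
  also have "(\<Prod>b\<in>(Basis :: (complex^'m) set). ennreal (sqrt (pi / k))) = ennreal ((pi / k) ^ CARD('m))"
  proof -
    have "sqrt (pi / k) ^ (2 * CARD('m)) = (pi / k) ^ CARD('m)"
      unfolding power_mult using k by simp
    then show ?thesis using k by (simp add: ennreal_power mult.commute)
  qed
  finally show "(\<integral>\<^sup>+z. ennreal (exp (- k * (norm (z::complex^'m))\<^sup>2)) \<partial>lborel) = ennreal ((pi / k) ^ CARD('m))" .
qed (use k in auto)

lemma pair_integral_mult:
  fixes f g :: "_ \<Rightarrow> 'c::{real_normed_field,banach,second_countable_topology}"
  assumes "pair_sigma_finite M1 M2" and f: "integrable M1 f" and g: "integrable M2 g"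
  shows "integrable (M1 \<Otimes>\<^sub>M M2) (\<lambda>p. f (fst p) * g (snd p))"
    and "(\<integral>p. f (fst p) * g (snd p) \<partial>(M1 \<Otimes>\<^sub>M M2)) = integral\<^sup>L M1 f * integral\<^sup>L M2 g"
proof -
  interpret pair_sigma_finite M1 M2 by fact
  have [measurable]: "f \<in> borel_measurable M1" "g \<in> borel_measurable M2"
    using f g by auto
  show i: "integrable (M1 \<Otimes>\<^sub>M M2) (\<lambda>p. f (fst p) * g (snd p))"
    using f g by (intro Fubini_integrable) (auto simp: norm_mult)
  from integral_fst'[OF i] show "(\<integral>p. f (fst p) * g (snd p) \<partial>(M1 \<Otimes>\<^sub>M M2)) = integral\<^sup>L M1 f * integral\<^sup>L M2 g"
    by simp
qed

section \<open>The Segal-Bargmann space\<close>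

lemma sb_holomorphic_continuous: "sb_holomorphic f \<Longrightarrow> continuous_on UNIV f"
  unfolding sb_holomorphic_def by (meson continuous_at_imp_continuous_on has_derivative_continuous)

lemma sb_holomorphic_measurable [measurable_dest]: "sb_holomorphic f \<Longrightarrow> f \<in> borel_measurable borel"
  by (intro borel_measurable_continuous_onI sb_holomorphic_continuous)

lemma has_derivative_vec_scale_left: "((\<lambda>t. t *s v) has_derivative (\<lambda>t. t *s v)) (at t)"
  for v :: "complex^'m"
proof -
  have "linear (\<lambda>t. t *s v)" by (rule linearI) (auto simp: vec_eq_iff algebra_simps)
  then show ?thesis by (intro bounded_linear_imp_has_derivative) (simp add: linear_conv_bounded_linear)
qed

text \<open>Homogeneity of \<open>L\<close> over the complex numbers turns the real derivative along
  a complex line into a complex one. Mean values over circles and Cauchy's inequality become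
  available in this way.\<close>

lemma sb_derivative_along_line:
  fixes v :: "complex^'m"
  assumes "(f has_derivative L) (at (a + t *s v))" and "\<And>c. L (c *s v) = c * L v"
  shows "((\<lambda>t. f (a + t *s v)) has_field_derivative L v) (at t)"
proof -
  have "((\<lambda>t. a + t *s v) has_derivative (\<lambda>t. 0 + t *s v)) (at t)"
    by (intro has_derivative_add has_derivative_const has_derivative_vec_scale_left)
  then have "((\<lambda>t. f (a + t *s v)) has_derivative (\<lambda>t. L (0 + t *s v))) (at t)"
    using assms(1) by (rule has_derivative_compose)
  then show ?thesis
    unfolding has_field_derivative_def by (simp add: assms(2) mult.commute[of _ "L v"])
qed

lemma sb_holomorphic_along_line:
  assumes "sb_holomorphic f"
  shows "(\<lambda>t. f (a + t *s v)) holomorphic_on UNIV"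
  unfolding holomorphic_on_open[OF open_UNIV]
  using assms sb_derivative_along_line unfolding sb_holomorphic_def by metis

lemma sb_holomorphic_lin:
  assumes "sb_holomorphic f" "sb_holomorphic g"
  shows "sb_holomorphic (\<lambda>z. a * f z + b * g z)"
  unfolding sb_holomorphic_def
proof
  fix z
  obtain L K where L: "(f has_derivative L) (at z)" "\<forall>c v. L (c *s v) = c * L v"
    and K: "(g has_derivative K) (at z)" "\<forall>c v. K (c *s v) = c * K v"
    using assms unfolding sb_holomorphic_def by metis
  have "((\<lambda>z. a * f z + b * g z) has_derivative (\<lambda>v. a * L v + b * K v)) (at z)"
    by (intro has_derivative_add has_derivative_mult_right L K)
  then show "\<exists>L. ((\<lambda>z. a * f z + b * g z) has_derivative L) (at z) \<and> (\<forall>c v. L (c *s v) = c * L v)"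
    using L K by (intro exI conjI) (assumption, simp add: algebra_simps)
qed

lemma sb_holomorphic_mult:
  assumes "sb_holomorphic f" "sb_holomorphic g"
  shows "sb_holomorphic (\<lambda>z. f z * g z)"
  unfolding sb_holomorphic_def
proof
  fix z
  obtain L K where L: "(f has_derivative L) (at z)" "\<forall>c v. L (c *s v) = c * L v"
    and K: "(g has_derivative K) (at z)" "\<forall>c v. K (c *s v) = c * K v"
    using assms unfolding sb_holomorphic_def by metis
  have "((\<lambda>z. f z * g z) has_derivative (\<lambda>v. f z * K v + L v * g z)) (at z)"
    by (intro has_derivative_mult L K)
  then show "\<exists>L. ((\<lambda>z. f z * g z) has_derivative L) (at z) \<and> (\<forall>c v. L (c *s v) = c * L v)"
    using L K by (intro exI conjI) (assumption, simp add: algebra_simps)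
qed

lemma sb_holomorphic_compose_affine:
  fixes T :: "complex^'a \<Rightarrow> complex^'b"
  assumes f: "sb_holomorphic f" and T: "linear T" "\<And>c v. T (c *s v) = c *s T v"
  shows "sb_holomorphic (\<lambda>z. f (T z + a))"
  unfolding sb_holomorphic_def
proof
  fix z
  obtain L where L: "(f has_derivative L) (at (T z + a))" "\<forall>c v. L (c *s v) = c * L v"
    using f unfolding sb_holomorphic_def by metis
  have "(T has_derivative T) (at z)"
    using T(1) by (intro bounded_linear_imp_has_derivative) (simp add: linear_conv_bounded_linear)
  then have "((\<lambda>z. T z + a) has_derivative (\<lambda>v. T v + 0)) (at z)"
    by (intro has_derivative_add has_derivative_const)
  then have "((\<lambda>z. f (T z + a)) has_derivative (\<lambda>v. L (T v + 0))) (at z)"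
    using L(1) by (rule has_derivative_compose)
  then show "\<exists>L. ((\<lambda>z. f (T z + a)) has_derivative L) (at z) \<and> (\<forall>c v. L (c *s v) = c * L v)"
    using L(2) T(2) by (intro exI conjI) (assumption, simp)
qed

section \<open>The Hermitian pairing\<close>

definition herm :: "complex^'m \<Rightarrow> complex^'m \<Rightarrow> complex" where
  "herm z w = (\<Sum>j\<in>UNIV. z $ j * cnj (w $ j))"

lemma herm_add: "herm (x + y) w = herm x w + herm y w" "herm w (x + y) = herm w x + herm w y"
  by (simp_all add: herm_def algebra_simps sum.distrib)

lemma herm_scale: "herm (a *s x) w = a * herm x w"
  by (simp add: herm_def sum_distrib_left mult.assoc)

lemma herm_cnj: "cnj (herm x y) = herm y x"
  by (simp add: herm_def mult.commute)

lemma herm_minus_right: "herm x (- y) = - herm x y"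
  by (simp add: herm_def sum_negf)

lemma herm_zero_left: "herm 0 y = 0"
  by (simp add: herm_def)

lemma herm_self: "herm z z = of_real ((norm z)\<^sup>2)"
proof -
  have "(norm z)\<^sup>2 = (\<Sum>j\<in>UNIV. (cmod (z $ j))\<^sup>2)"
    by (simp add: norm_vec_def L2_set_def sum_nonneg)
  then show ?thesis by (simp only: herm_def of_real_sum complex_norm_square)
qed

lemma norm_add_square: "(norm (x + y))\<^sup>2 = (norm x)\<^sup>2 + (norm y)\<^sup>2 + 2 * Re (herm x y)"
  for x y :: "complex^'m"
proof -
  have "complex_of_real ((norm (x + y))\<^sup>2) = of_real ((norm x)\<^sup>2 + (norm y)\<^sup>2) + (herm x y + cnj (herm x y))"
    unfolding herm_cnj unfolding herm_self[symmetric] of_real_add herm_add by (simp add: algebra_simps)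
  also have "\<dots> = of_real ((norm x)\<^sup>2 + (norm y)\<^sup>2 + 2 * Re (herm x y))"
    unfolding complex_add_cnj by simp
  finally show ?thesis unfolding of_real_eq_iff .
qed

lemma sb_holomorphic_exp_herm: "sb_holomorphic (\<lambda>z. exp (c * herm z p))"
  unfolding sb_holomorphic_def
proof
  fix z
  have "linear (\<lambda>z. c * herm z p)"
    by (rule linearI) (auto simp: herm_def algebra_simps sum.distrib sum_distrib_left scaleR_sum_right)
  then have "((\<lambda>z. c * herm z p) has_derivative (\<lambda>v. c * herm v p)) (at z)"
    by (intro bounded_linear_imp_has_derivative) (simp add: linear_conv_bounded_linear)
  moreover have "(exp has_derivative (\<lambda>h. exp (c * herm z p) * h)) (at (c * herm z p))"
    using DERIV_exp[of "c * herm z p"] unfolding has_field_derivative_def .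
  ultimately have "((\<lambda>z. exp (c * herm z p)) has_derivative (\<lambda>v. exp (c * herm z p) * (c * herm v p))) (at z)"
    by (rule has_derivative_compose)
  then show "\<exists>L. ((\<lambda>z. exp (c * herm z p)) has_derivative L) (at z) \<and> (\<forall>a v. L (a *s v) = a * L v)"
    by (intro exI conjI) (assumption, simp only: herm_scale, simp add: mult_ac)
qed

lemma norm_vec_smult: "norm (c *s v) = cmod c * norm v" for v :: "complex^'m"
  by (simp add: norm_vec_def norm_mult L2_set_right_distrib)

section \<open>Integrability and vector space structure\<close>

lemma sb_space_iff: "f \<in> sb_space k \<longleftrightarrow> sb_holomorphic f \<and>
    integrable lborel (\<lambda>z. (cmod (f z))\<^sup>2 * exp (- real k * (norm z)\<^sup>2))"
  by (simp add: sb_space_def)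

lemma sb_integrable:
  assumes "f \<in> sb_space k" "g \<in> sb_space k"
  shows "integrable lborel (\<lambda>z. f z * cnj (g z) * complex_of_real (exp (- real k * (norm z)\<^sup>2)))"
proof (rule Bochner_Integration.integrable_bound)
  show "integrable lborel (\<lambda>z. (cmod (f z))\<^sup>2 * exp (- real k * (norm z)\<^sup>2) + (cmod (g z))\<^sup>2 * exp (- real k * (norm z)\<^sup>2))"
    using assms by (intro Bochner_Integration.integrable_add) (auto simp: sb_space_iff)
  show "(\<lambda>z. f z * cnj (g z) * complex_of_real (exp (- real k * (norm z)\<^sup>2))) \<in> borel_measurable lborel"
    unfolding measurable_lborel2
    by (intro borel_measurable_continuous_onI continuous_intros sb_holomorphic_continuous)
      (use assms in \<open>auto simp: sb_space_iff\<close>)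
  show "AE z in lborel. norm (f z * cnj (g z) * complex_of_real (exp (- real k * (norm z)\<^sup>2)))
     \<le> norm ((cmod (f z))\<^sup>2 * exp (- real k * (norm z)\<^sup>2) + (cmod (g z))\<^sup>2 * exp (- real k * (norm z)\<^sup>2))"
  proof (rule AE_I2)
    fix z
    have "cmod (f z) * cmod (g z) \<le> (cmod (f z))\<^sup>2 + (cmod (g z))\<^sup>2"
      using sum_squares_bound[of "cmod (f z)" "cmod (g z)"] mult_nonneg_nonneg[OF norm_ge_zero norm_ge_zero, of "f z" "g z"]
      by linarith
    then have "cmod (f z) * cmod (g z) * exp (- real k * (norm z)\<^sup>2) \<le> ((cmod (f z))\<^sup>2 + (cmod (g z))\<^sup>2) * exp (- real k * (norm z)\<^sup>2)"
      by (rule mult_right_mono) simp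
    then show "norm (f z * cnj (g z) * complex_of_real (exp (- real k * (norm z)\<^sup>2)))
       \<le> norm ((cmod (f z))\<^sup>2 * exp (- real k * (norm z)\<^sup>2) + (cmod (g z))\<^sup>2 * exp (- real k * (norm z)\<^sup>2))"
      by (simp add: norm_mult distrib_right)
  qed
qed

lemma sb_space_zero: "(\<lambda>_. 0) \<in> sb_space k"
  unfolding sb_space_iff sb_holomorphic_def by (auto intro!: exI[of _ "\<lambda>_. 0"])

lemma const_one_in_sb_space:
  assumes "k > 0"
  shows "(\<lambda>_::complex^'m. 1) \<in> sb_space k"
  using has_bochner_integral_gaussian[of "real k", where 'm='m] assms
  unfolding sb_space_iff sb_holomorphic_def
  by (auto intro!: exI[of _ "\<lambda>_. 0"] simp: has_bochner_integral_iff)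

lemma sb_space_lin:
  assumes "f \<in> sb_space k" "g \<in> sb_space k"
  shows "(\<lambda>z. a * f z + b * g z) \<in> sb_space k"
  unfolding sb_space_iff
proof
  show h: "sb_holomorphic (\<lambda>z. a * f z + b * g z)"
    using assms by (intro sb_holomorphic_lin) (auto simp: sb_space_iff)
  let ?e = "\<lambda>z. exp (- real k * (norm z)\<^sup>2)"
  show "integrable lborel (\<lambda>z. (cmod (a * f z + b * g z))\<^sup>2 * ?e z)"
  proof (rule Bochner_Integration.integrable_bound)
    show "integrable lborel (\<lambda>z. 2 * (cmod a)\<^sup>2 * ((cmod (f z))\<^sup>2 * ?e z) + 2 * (cmod b)\<^sup>2 * ((cmod (g z))\<^sup>2 * ?e z))"
      using assms by (intro Bochner_Integration.integrable_add integrable_mult_right) (auto simp: sb_space_iff)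
    have [measurable]: "(\<lambda>z. a * f z + b * g z) \<in> borel_measurable borel" by (rule sb_holomorphic_measurable[OF h])
    show "(\<lambda>z. (cmod (a * f z + b * g z))\<^sup>2 * ?e z) \<in> borel_measurable lborel" by measurable
    show "AE z in lborel. norm ((cmod (a * f z + b * g z))\<^sup>2 * ?e z)
       \<le> norm (2 * (cmod a)\<^sup>2 * ((cmod (f z))\<^sup>2 * ?e z) + 2 * (cmod b)\<^sup>2 * ((cmod (g z))\<^sup>2 * ?e z))"
    proof (rule AE_I2)
      fix z
      let ?x = "cmod a * cmod (f z)" and ?y = "cmod b * cmod (g z)"
      have "cmod (a * f z + b * g z) \<le> ?x + ?y" by (metis norm_mult norm_triangle_ineq)
      then have "(cmod (a * f z + b * g z))\<^sup>2 \<le> (?x + ?y)\<^sup>2" by (intro power_mono) auto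
      also have "\<dots> \<le> 2 * ?x\<^sup>2 + 2 * ?y\<^sup>2"
        using sum_squares_bound[of ?x ?y] by (simp add: power2_sum)
      finally have "(cmod (a * f z + b * g z))\<^sup>2 * ?e z \<le> (2 * ?x\<^sup>2 + 2 * ?y\<^sup>2) * ?e z"
        by (rule mult_right_mono) simp
      then show "norm ((cmod (a * f z + b * g z))\<^sup>2 * ?e z)
       \<le> norm (2 * (cmod a)\<^sup>2 * ((cmod (f z))\<^sup>2 * ?e z) + 2 * (cmod b)\<^sup>2 * ((cmod (g z))\<^sup>2 * ?e z))"
        by (simp add: distrib_right power_mult_distrib mult.assoc)
    qed
  qed
qed

lemma sb_inner_self:
  fixes f :: "complex^'m \<Rightarrow> complex"
  shows "sb_inner k f f = of_real ((real k / pi) ^ CARD('m) * (LINT z|lborel. (cmod (f z))\<^sup>2 * exp (- real k * (norm z)\<^sup>2)))"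
proof -
  have "(LINT z|lborel. f z * cnj (f z) * complex_of_real (exp (- real k * (norm z)\<^sup>2)))
      = (LINT z|lborel. complex_of_real ((cmod (f z))\<^sup>2 * exp (- real k * (norm z)\<^sup>2)))"
    by (rule Bochner_Integration.integral_cong) (simp_all only: of_real_mult complex_norm_square)
  then show ?thesis unfolding sb_inner_def integral_complex_of_real by simp
qed

section \<open>Mean values and the reproducing property\<close>

text \<open>Cauchy's integral formula at the centre of the unit circle; in this parametrisation du /
  u becomes 2 pi i dt.\<close>

lemma circle_mean_value:
  assumes h: "h holomorphic_on UNIV"
  shows "((\<lambda>t. h (exp (2 * of_real pi * \<i> * of_real t))) has_integral h 0) {0..1}"
proof -
  have "((\<lambda>u. h u / (u - 0)) has_contour_integral 2 * of_real pi * \<i> * h 0) (circlepath 0 1)"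
    by (rule Cauchy_integral_circlepath_simple) (use h in \<open>auto intro: holomorphic_on_subset\<close>)
  then have "((\<lambda>t. h (circlepath 0 1 t) / circlepath 0 1 t * vector_derivative (circlepath 0 1) (at t within {0..1}))
     has_integral 2 * of_real pi * \<i> * h 0) {0..1}"
    unfolding has_contour_integral_def by simp
  then have "((\<lambda>t. (2 * of_real pi * \<i>) * h (exp (2 * of_real pi * \<i> * of_real t))) has_integral 2 * of_real pi * \<i> * h 0) {0..1}"
    by (rule has_integral_eq[rotated]) (simp add: vector_derivative_circlepath01, simp add: circlepath)
  from has_integral_mult_right[OF this, of "1 / (2 * of_real pi * \<i>)"] show ?thesis by simp
qed

text \<open>The Gaussian weight is rotation invariant, so \<open>f\<close> may be replaced by its average over the
  circles \<open>t \<mapsto> exp (2 \<pi> i t) z\<close>, which is \<open>f 0\<close>.\<close>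
lemma gaussian_mean_value:
  fixes f :: "complex^'m \<Rightarrow> complex"
  assumes f: "f \<in> sb_space k" and k: "k > 0"
  shows "(LINT z|lborel. f z * complex_of_real (exp (- real k * (norm z)\<^sup>2))) = of_real ((pi / real k) ^ CARD('m)) * f 0"
proof -
  let ?G = "\<lambda>z::complex^'m. complex_of_real (exp (- real k * (norm z)\<^sup>2))"
  have gi: "has_bochner_integral lborel (\<lambda>z::complex^'m. exp (- real k * (norm z)\<^sup>2)) ((pi / real k) ^ CARD('m))"
    by (rule has_bochner_integral_gaussian) (use k in simp)
  define F where "F z = f z * ?G z" for z
  have holf: "sb_holomorphic f" using f by (simp add: sb_space_iff)
  have F: "integrable lborel F" using sb_integrable[OF f const_one_in_sb_space[OF k]] by (simp add: F_def[abs_def])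
  have contF: "continuous_on UNIV F" unfolding F_def
    by (intro continuous_intros sb_holomorphic_continuous[OF holf])
  define E where "E t = exp (2 * of_real pi * \<i> * of_real t)" for t :: real
  have E1: "cmod (E t) = 1" for t by (simp add: E_def norm_exp_eq_Re)
  have nE: "norm (E t *s z) = norm z" for t and z :: "complex^'m"
    by (simp add: norm_vec_def norm_mult E1)
  have FE: "F (E t *s z) = f (E t *s z) * ?G z" for t z by (simp add: F_def nE)
  have rot: "distr lborel borel (\<lambda>z. E t *s z) = (lborel :: (complex^'m) measure)" for t
    by (rule distr_lborel_vec_rotation[OF E1])
  have meas: "(\<lambda>z::complex^'m. E t *s z) \<in> borel_measurable borel" for t
    by (intro borel_measurable_continuous_onI continuous_intros)
  have FEi: "integrable lborel (\<lambda>z. F (E t *s z))" for t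
    using F integrable_distr[of "\<lambda>z. E t *s z" lborel borel F] meas rot[of t] by simp
  have FEI: "(LINT z|lborel. F (E t *s z)) = integral\<^sup>L lborel F" for t
    using integral_distr[of "\<lambda>z. E t *s z" lborel borel F] meas rot[of t] F by simp
  have nFEI: "(LINT z|lborel. norm (F (E t *s z))) = (LINT z|lborel. norm (F z))" for t
    using integral_distr[of "\<lambda>z. E t *s z" lborel borel "\<lambda>z. norm (F z)"] meas rot[of t] F by simp
  define H where "H t z = indicator {0..1} t *\<^sub>R F (E t *s z)" for t :: real and z
  have mH: "(\<lambda>p. H (fst p) (snd p)) \<in> borel_measurable (lborel \<Otimes>\<^sub>M lborel)"
  proof -
    have "continuous_on UNIV (\<lambda>p::real \<times> (complex^'m). F (E (fst p) *s snd p))"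
      unfolding E_def by (intro continuous_on_compose2[OF contF] continuous_intros) auto
    then have [measurable]: "(\<lambda>p::real \<times> (complex^'m). F (E (fst p) *s snd p)) \<in> borel_measurable (borel \<Otimes>\<^sub>M borel)"
      unfolding borel_prod by (rule borel_measurable_continuous_onI)
    show ?thesis unfolding H_def by measurable
  qed
  have ind: "integrable lborel (\<lambda>t::real. indicator {0..1} t * c)" for c :: real
    by (intro integrable_mult_left) auto
  \<comment> \<open>Rotation invariance makes the inner integral of the norm independent of
    \<open>t\<close>, which gives integrability on the product.\<close>
  have Hi: "integrable (lborel \<Otimes>\<^sub>M lborel) (\<lambda>p. H (fst p) (snd p))"
  proof (rule lborel_pair.Fubini_integrable[OF mH])
    show "integrable lborel (\<lambda>t. LINT z|lborel. norm (H (fst (t, z)) (snd (t, z))))"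
      using ind[of "LINT z|lborel. norm (F z)"] by (simp add: H_def nFEI)
    show "AE t in lborel. integrable lborel (\<lambda>z. H (fst (t, z)) (snd (t, z)))"
      by (simp add: H_def FEi)
  qed
  have "integral\<^sup>L lborel F = (LINT t|lborel. LINT z|lborel. H t z)"
    by (simp add: H_def FEI)
  also have "\<dots> = (LINT z|lborel. LINT t|lborel. H t z)"
    by (rule lborel_pair.Fubini_integral[symmetric]) (unfold case_prod_beta', rule Hi)
  also have "\<dots> = (LINT z|lborel. f 0 * ?G z)"
  proof (rule Bochner_Integration.integral_cong[OF refl])
    fix z :: "complex^'m"
    have "((\<lambda>t. f (0 + E t *s z)) has_integral f (0 + 0 *s z)) {0..1}"
      using circle_mean_value[OF sb_holomorphic_along_line[OF holf, of 0 z]] by (simp add: E_def)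
    then have hi: "((\<lambda>t. F (E t *s z)) has_integral f 0 * ?G z) {0..1}"
      unfolding FE by (intro has_integral_mult_left) simp
    have "continuous_on {0..1} (\<lambda>t. F (E t *s z))"
      unfolding E_def by (intro continuous_on_compose2[OF contF] continuous_intros) auto
    then have si: "set_integrable lborel {0..1} (\<lambda>t. F (E t *s z))"
      by (intro borel_integrable_atLeastAtMost') auto
    have "(LINT t|lborel. H t z) = (LINT t:{0..1}|lborel. F (E t *s z))"
      by (simp add: H_def set_lebesgue_integral_def)
    also have "\<dots> = integral {0..1} (\<lambda>t. F (E t *s z))" by (rule set_borel_integral_eq_integral[OF si])
    also have "\<dots> = f 0 * ?G z" by (rule integral_unique[OF hi])
    finally show "(LINT t|lborel. H t z) = f 0 * ?G z" .
  qed
  also have "\<dots> = f 0 * of_real ((pi / real k) ^ CARD('m))"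
    using gi by (simp only: integral_mult_right_zero integral_complex_of_real has_bochner_integral_iff)
  finally show ?thesis by (simp add: F_def[abs_def] mult.commute)
qed

lemma theta_eq: "theta k p = (\<lambda>z. exp (of_nat k * herm z p))"
  by (simp add: theta_def herm_def)

lemma of_real_exp_mult:
  "complex_of_real (exp (real k * r)) = exp (of_nat k * of_real r)"
  "complex_of_real (exp (- real k * r)) = exp (- of_nat k * of_real r)"
  by (simp_all flip: exp_of_real)

lemma lborel_integral_shift:
  fixes f :: "'a::euclidean_space \<Rightarrow> 'b::{banach, second_countable_topology}"
  assumes "f \<in> borel_measurable borel"
  shows "integral\<^sup>L lborel f = (LINT x|lborel. f (x + a))"
    and "integrable lborel f \<Longrightarrow> integrable lborel (\<lambda>x. f (x + a))"
  using integral_distr[of "(+) a" lborel borel f] integrable_distr[of "(+) a" lborel borel f] assms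
  by (simp_all add: lborel_distr_plus add.commute)

text \<open>Up to a constant this is the unitary Weyl translation: the exponential compensates the
  change of the weight, because |w + p|^2 = |w|^2 + |p|^2 + 2 Re (herm w p).\<close>

lemma sb_space_translate:
  fixes f :: "complex^'m \<Rightarrow> complex"
  assumes f: "f \<in> sb_space k"
  shows "(\<lambda>w. f (w + p) * exp (- of_nat k * herm w p)) \<in> sb_space k"
  unfolding sb_space_iff
proof
  have h: "sb_holomorphic f" using f by (simp add: sb_space_iff)
  show "sb_holomorphic (\<lambda>w. f (w + p) * exp (- of_nat k * herm w p))"
    by (intro sb_holomorphic_mult sb_holomorphic_exp_herm sb_holomorphic_compose_affine[OF h linear_id[unfolded id_def]]) simp
  have [measurable]: "f \<in> borel_measurable borel" by (rule sb_holomorphic_measurable[OF h])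
  have "integrable lborel (\<lambda>w. (cmod (f (w + p)))\<^sup>2 * exp (- real k * (norm (w + p))\<^sup>2))"
    by (rule lborel_integral_shift(2)[of "\<lambda>w. (cmod (f w))\<^sup>2 * exp (- real k * (norm w)\<^sup>2)"])
      (use f in \<open>auto simp: sb_space_iff\<close>)
  then have "integrable lborel (\<lambda>w. exp (real k * (norm p)\<^sup>2) * ((cmod (f (w + p)))\<^sup>2 * exp (- real k * (norm (w + p))\<^sup>2)))"
    by (rule integrable_mult_right)
  moreover have "exp (real k * (norm p)\<^sup>2) * ((cmod (f (w + p)))\<^sup>2 * exp (- real k * (norm (w + p))\<^sup>2))
     = (cmod (f (w + p) * exp (- of_nat k * herm w p)))\<^sup>2 * exp (- real k * (norm w)\<^sup>2)" for w
  proof -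
    have "cmod (exp (- of_nat k * herm w p)) = exp (- real k * Re (herm w p))"
      by (simp add: norm_exp_eq_Re)
    then show ?thesis
      unfolding norm_mult power_mult_distrib norm_add_square
      by (simp add: power2_eq_square[of "exp _"] algebra_simps flip: exp_add)
  qed
  ultimately show "integrable lborel (\<lambda>w. (cmod (f (w + p) * exp (- of_nat k * herm w p)))\<^sup>2 * exp (- real k * (norm w)\<^sup>2))"
    by (simp only:)
qed

text \<open>Coherent states are the Weyl translates of the constant function 1.\<close>

lemma theta_in_sb_space:
  fixes p :: "complex^'m"
  assumes k: "k > 0"
  shows "theta k p \<in> sb_space k"
proof -
  from sb_space_translate[OF const_one_in_sb_space[OF k], of "- p"] show ?thesis by (simp add: theta_eq herm_minus_right)
qed

text \<open>The substitution z = w + p turns the integrand into the Weyl translate of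
  \<open>f\<close> times the Gaussian, and the mean value property evaluates that translate at 0,
  where it equals \<open>f p\<close>.\<close>

theorem sb_reproducing:
  fixes f :: "complex^'m \<Rightarrow> complex"
  assumes f: "f \<in> sb_space k" and k: "k > 0"
  shows "sb_inner k f (theta k p) = f p"
proof -
  let ?G = "\<lambda>z::complex^'m. complex_of_real (exp (- real k * (norm z)\<^sup>2))"
  let ?I = "\<lambda>z. f z * cnj (theta k p z) * ?G z"
  have "?I \<in> borel_measurable borel"
    using sb_integrable[OF f theta_in_sb_space[OF k, of p]] by (auto dest: borel_measurable_integrable)
  then have "integral\<^sup>L lborel ?I = (LINT w|lborel. ?I (w + p))"
    by (rule lborel_integral_shift(1))
  also have "\<dots> = (LINT w|lborel. (f (w + p) * exp (- of_nat k * herm w p)) * ?G w)"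
  proof (rule Bochner_Integration.integral_cong[OF refl])
    fix w
    \<comment> \<open>The terms \<open>herm p w\<close> and \<open>herm p p\<close> cancel against
      the expansion of the squared norm of \<open>w + p\<close>, leaving the translation factor and
      the Gaussian at \<open>w\<close>.\<close>
    have "cnj (theta k p (w + p)) * ?G (w + p)
        = exp (of_nat k * herm p (w + p) - of_nat k * of_real ((norm (w + p))\<^sup>2))"
      unfolding of_real_exp_mult theta_eq exp_cnj complex_cnj_mult herm_cnj
      by (simp add: exp_diff exp_minus divide_inverse)
    also have "of_nat k * herm p (w + p) - of_nat k * of_real ((norm (w + p))\<^sup>2)
        = - of_nat k * herm w p + - of_nat k * of_real ((norm w)\<^sup>2)"
      unfolding herm_self[symmetric] herm_add by (simp add: algebra_simps)
    finally have "cnj (theta k p (w + p)) * ?G (w + p) = exp (- of_nat k * herm w p) * ?G w"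
      unfolding of_real_exp_mult exp_add by simp
    then show "?I (w + p) = (f (w + p) * exp (- of_nat k * herm w p)) * ?G w"
      by (simp add: mult.assoc)
  qed
  also have "\<dots> = of_real ((pi / real k) ^ CARD('m)) * f p"
    by (subst gaussian_mean_value[OF sb_space_translate[OF f] k]) (simp add: herm_zero_left)
  finally have "sb_inner k f (theta k p) = of_real ((real k / pi) ^ CARD('m)) * (of_real ((pi / real k) ^ CARD('m)) * f p)"
    unfolding sb_inner_def by simp
  also have "\<dots> = of_real ((real k / pi * (pi / real k)) ^ CARD('m)) * f p"
    by (simp only: power_mult_distrib of_real_mult mult.assoc)
  also have "real k / pi * (pi / real k) = 1" using k by simp
  finally show ?thesis by simp
qed

section \<open>Inner product, pointwise bounds and completeness\<close>

lemma sb_inner_fun_space: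
  assumes k: "k > 0"
  shows "inner_fun_space (sb_space k :: (complex^'m \<Rightarrow> complex) set) (sb_inner k)"
proof
  show "(\<lambda>_. 0) \<in> sb_space k" by (rule sb_space_zero)
  fix f g h :: "complex^'m \<Rightarrow> complex" and a b
  assume f: "f \<in> sb_space k" and g: "g \<in> sb_space k"
  show "(\<lambda>z. a * f z + b * g z) \<in> sb_space k" by (rule sb_space_lin[OF f g])
  show "sb_inner k (\<lambda>z. a * f z + b * g z) h = a * sb_inner k f h + b * sb_inner k g h" if h: "h \<in> sb_space k"
  proof -
    let ?G = "\<lambda>z::complex^'m. complex_of_real (exp (- real k * (norm z)\<^sup>2))"
    have "(LINT z|lborel. (a * f z + b * g z) * cnj (h z) * ?G z)
      = (LINT z|lborel. a * (f z * cnj (h z) * ?G z) + b * (g z * cnj (h z) * ?G z))"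
      by (rule Bochner_Integration.integral_cong) (auto simp: algebra_simps)
    also have "\<dots> = a * (LINT z|lborel. f z * cnj (h z) * ?G z) + b * (LINT z|lborel. g z * cnj (h z) * ?G z)"
      using sb_integrable[OF f h] sb_integrable[OF g h]
      by (subst Bochner_Integration.integral_add) auto
    finally show ?thesis unfolding sb_inner_def by (simp add: algebra_simps)
  qed
  show "cnj (sb_inner k f g) = sb_inner k g f"
  proof -
    let ?G = "\<lambda>z::complex^'m. complex_of_real (exp (- real k * (norm z)\<^sup>2))"
    have "cnj (LINT z|lborel. f z * cnj (g z) * ?G z) = (LINT z|lborel. cnj (f z * cnj (g z) * ?G z))"
      by (rule Bochner_Integration.integral_cnj[symmetric])
    also have "\<dots> = (LINT z|lborel. g z * cnj (f z) * ?G z)"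
      by (rule Bochner_Integration.integral_cong) simp_all
    finally show ?thesis unfolding sb_inner_def by simp
  qed
  show "0 \<le> Re (sb_inner k f f)"
    unfolding sb_inner_self by (simp add: Bochner_Integration.integral_nonneg)
  \<comment> \<open>A vanishing integral yields \<open>f = 0\<close> only almost everywhere; the
    reproducing property upgrades this to every point.\<close>
  show "f = (\<lambda>_. 0)" if z: "sb_inner k f f = 0"
  proof
    fix p
    have "(LINT z|lborel. (cmod (f z))\<^sup>2 * exp (- real k * (norm z)\<^sup>2)) = 0"
      using z k unfolding sb_inner_self by simp
    then have "AE z in lborel. (cmod (f z))\<^sup>2 * exp (- real k * (norm z)\<^sup>2) = 0"
      using f by (subst (asm) integral_nonneg_eq_0_iff_AE) (auto simp: sb_space_iff)
    then have ae: "AE z in lborel. f z * cnj (theta k p z) * complex_of_real (exp (- real k * (norm z)\<^sup>2)) = 0"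
      by eventually_elim simp
    have "sb_inner k f (theta k p) = 0"
      unfolding sb_inner_def using integral_eq_zero_AE[OF ae] by simp
    then show "f p = 0" using sb_reproducing[OF f k] by simp
  qed
qed

text \<open>Cauchy-Schwarz applied to the reproducing formula; the exponential is the squared norm
  of \<open>theta k p\<close>.\<close>

lemma sb_pointwise_bound:
  fixes f :: "complex^'m \<Rightarrow> complex"
  assumes f: "f \<in> sb_space k" and k: "k > 0"
  shows "(cmod (f p))\<^sup>2 \<le> exp (real k * (norm p)\<^sup>2) * Re (sb_inner k f f)"
proof -
  interpret inner_fun_space "sb_space k :: (complex^'m \<Rightarrow> complex) set" "sb_inner k"
    by (rule sb_inner_fun_space[OF k])
  have t: "theta k p \<in> sb_space k" by (rule theta_in_sb_space[OF k])
  have "sb_inner k (theta k p) (theta k p) = exp (of_nat k * of_real ((norm p)\<^sup>2))"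
    unfolding sb_reproducing[OF t k] by (simp only: theta_eq herm_self)
  also have "\<dots> = of_real (exp (real k * (norm p)\<^sup>2))" by (simp only: of_real_exp_mult)
  finally show ?thesis
    using Cauchy_Schwarz[OF f t] by (simp add: sb_reproducing[OF f k] mult.commute)
qed

text \<open>Cauchy's inequality on the unit disc in the complex line through \<open>z\<close> in
  direction \<open>v\<close>. That disc stays in the ball of radius \<open>R + 1\<close>, hence the
  constant.\<close>

lemma sb_derivative_bound:
  fixes h :: "complex^'m \<Rightarrow> complex"
  assumes h: "h \<in> sb_space k" and k: "k > 0" and z: "norm z \<le> R"
    and L: "(h has_derivative L) (at z)" "\<And>c v. L (c *s v) = c * L v"
  shows "cmod (L v) \<le> sqrt (exp (real k * (R + 1)\<^sup>2) * Re (sb_inner k h h)) * norm v"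
proof (cases "v = 0")
  case True
  then show ?thesis using L(2)[of 0 v] by simp
next
  case False
  define B where "B = sqrt (exp (real k * (R + 1)\<^sup>2) * Re (sb_inner k h h))"
  interpret inner_fun_space "sb_space k :: (complex^'m \<Rightarrow> complex) set" "sb_inner k"
    by (rule sb_inner_fun_space[OF k])
  define w where "w = complex_of_real (1 / norm v) *s v"
  have nw: "norm (t *s w) = cmod t" for t
    using False by (simp add: w_def vector_smult_assoc norm_vec_smult norm_mult norm_divide)
  have hol: "(\<lambda>t. h (z + t *s w)) holomorphic_on UNIV"
    by (rule sb_holomorphic_along_line) (use h in \<open>simp add: sb_space_iff\<close>)
  have "cmod ((deriv ^^ 1) (\<lambda>t. h (z + t *s w)) 0) \<le> fact 1 * B / 1 ^ 1"
  proof (rule Cauchy_inequality)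
    show "cmod (h (z + t *s w)) \<le> B" if "cmod (0 - t) = 1" for t
    proof -
      have "norm (z + t *s w) \<le> R + 1" using norm_triangle_ineq[of z "t *s w"] z that by (simp add: nw)
      then have "(norm (z + t *s w))\<^sup>2 \<le> (R + 1)\<^sup>2" by (intro power_mono) auto
      then have "exp (real k * (norm (z + t *s w))\<^sup>2) * Re (sb_inner k h h) \<le> exp (real k * (R + 1)\<^sup>2) * Re (sb_inner k h h)"
        using ip_nonneg[OF h] by (intro mult_right_mono) (auto intro: mult_left_mono)
      with sb_pointwise_bound[OF h k, of "z + t *s w"]
      show ?thesis unfolding B_def by (intro real_le_rsqrt) linarith
    qed
  qed (use hol in \<open>auto intro: holomorphic_on_subset holomorphic_on_imp_continuous_on\<close>)
  moreover have "((\<lambda>t. h (z + t *s w)) has_field_derivative L w) (at 0)"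
    using L by (intro sb_derivative_along_line) auto
  ultimately have "cmod (L w) \<le> B" by (simp add: DERIV_imp_deriv)
  moreover have "L w = complex_of_real (1 / norm v) * L v" unfolding w_def by (rule L(2))
  ultimately show ?thesis using False by (simp add: B_def norm_mult norm_divide field_simps)
qed

text \<open>Meant for the differences \<open>X n - X m\<close> as \<open>m\<close> grows: it yields
  at once that \<open>X n - g\<close> is square-integrable and that its norm is small.\<close>

lemma sb_space_Fatou:
  fixes h :: "nat \<Rightarrow> complex^'m \<Rightarrow> complex"
  assumes k: "k > 0" and h: "\<And>n. h n \<in> sb_space k" and g: "sb_holomorphic g" and lim: "\<And>z. (\<lambda>n. h n z) \<longlonglongrightarrow> g z"
    and bd: "\<And>n. n \<ge> N \<Longrightarrow> Re (sb_inner k (h n) (h n)) \<le> \<epsilon>"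
  shows "g \<in> sb_space k" and "Re (sb_inner k g g) \<le> \<epsilon>"
proof -
  let ?D = "\<lambda>f z. (cmod (f z))\<^sup>2 * exp (- real k * (norm (z::complex^'m))\<^sup>2)"
  define K where "K = (real k / pi) ^ CARD('m)"
  have K: "K > 0" using k by (simp add: K_def)
  have nn: "(LINT z|lborel. ?D f z) \<ge> 0" for f by (simp add: Bochner_Integration.integral_nonneg)
  have ipD: "Re (sb_inner k f f) = K * (LINT z|lborel. ?D f z)" for f :: "complex^'m \<Rightarrow> complex"
    unfolding sb_inner_self K_def by simp
  have [measurable]: "h n \<in> borel_measurable borel" for n
    using h by (auto simp: sb_space_iff intro: sb_holomorphic_measurable)
  have [measurable]: "g \<in> borel_measurable borel" by (rule sb_holomorphic_measurable[OF g])
  \<comment> \<open>\<open>ennreal\<close> truncates negative numbers, so this is required before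
    the bound can be read back in the reals.\<close>
  have e0: "0 \<le> \<epsilon>" using bd[of N] nn[of "h N"] K unfolding ipD by (meson mult_nonneg_nonneg order.strict_implies_order order.trans order_refl)
  have "(\<integral>\<^sup>+z. ennreal (?D g z) \<partial>lborel) = (\<integral>\<^sup>+z. liminf (\<lambda>n. ennreal (?D (h n) z)) \<partial>lborel)"
  proof (rule nn_integral_cong)
    fix z
    have "(\<lambda>n. ennreal (?D (h n) z)) \<longlonglongrightarrow> ennreal (?D g z)"
      by (intro tendsto_ennrealI tendsto_intros lim)
    then show "ennreal (?D g z) = liminf (\<lambda>n. ennreal (?D (h n) z))"
      by (intro lim_imp_Liminf[symmetric]) auto
  qed
  also have "\<dots> \<le> liminf (\<lambda>n. \<integral>\<^sup>+z. ennreal (?D (h n) z) \<partial>lborel)"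
    by (rule nn_integral_liminf) measurable
  also have "\<dots> \<le> ennreal (\<epsilon> / K)"
  proof (rule Liminf_le)
    show "\<forall>\<^sub>F n in sequentially. (\<integral>\<^sup>+z. ennreal (?D (h n) z) \<partial>lborel) \<le> ennreal (\<epsilon> / K)"
    proof (rule eventually_sequentiallyI)
      fix n assume "n \<ge> N"
      have "(\<integral>\<^sup>+z. ennreal (?D (h n) z) \<partial>lborel) = ennreal (LINT z|lborel. ?D (h n) z)"
        using h by (intro nn_integral_eq_integral) (auto simp: sb_space_iff)
      also have "\<dots> \<le> ennreal (\<epsilon> / K)"
        using bd[OF \<open>n \<ge> N\<close>] K unfolding ipD by (intro ennreal_leI) (simp add: field_simps)
      finally show "(\<integral>\<^sup>+z. ennreal (?D (h n) z) \<partial>lborel) \<le> ennreal (\<epsilon> / K)" .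
    qed
  qed simp
  finally have le: "(\<integral>\<^sup>+z. ennreal (?D g z) \<partial>lborel) \<le> ennreal (\<epsilon> / K)" .
  have int: "integrable lborel (?D g)"
    using le by (intro integrableI_bounded) (auto simp: top_unique less_top[symmetric] intro: le_less_trans)
  then show "g \<in> sb_space k" using g by (simp add: sb_space_iff)
  have "ennreal (LINT z|lborel. ?D g z) \<le> ennreal (\<epsilon> / K)"
    using le nn_integral_eq_integral[OF int] by simp
  then have "(LINT z|lborel. ?D g z) \<le> \<epsilon> / K" using e0 K by (subst (asm) ennreal_le_iff) auto
  then show "Re (sb_inner k g g) \<le> \<epsilon>" using K unfolding ipD by (simp add: field_simps)
qed

theorem sb_hilbert_fun_space:
  assumes k: "k > 0"
  shows "hilbert_fun_space (sb_space k :: (complex^'m \<Rightarrow> complex) set) (sb_inner k)"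
proof -
  interpret inner_fun_space "sb_space k :: (complex^'m \<Rightarrow> complex) set" "sb_inner k"
    by (rule sb_inner_fun_space[OF k])
  show ?thesis
  proof
    fix X :: "nat \<Rightarrow> complex^'m \<Rightarrow> complex"
    assume X: "\<And>n. X n \<in> sb_space k"
    define d where "d m n = Re (sb_inner k (\<lambda>z. X m z - X n z) (\<lambda>z. X m z - X n z))" for m n
    assume "\<And>\<epsilon>. 0 < \<epsilon> \<Longrightarrow> \<exists>N. \<forall>m\<ge>N. \<forall>n\<ge>N. Re (sb_inner k (\<lambda>z. X m z - X n z) (\<lambda>z. X m z - X n z)) < \<epsilon>"
    then have C: "\<exists>N. \<forall>m\<ge>N. \<forall>n\<ge>N. d m n < \<epsilon>" if "0 < \<epsilon>" for \<epsilon> using that by (simp add: d_def)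
    have DV: "(\<lambda>z. X m z - X n z) \<in> sb_space k" for m n by (rule diff_mem[OF X X])
    have "\<forall>n z. \<exists>L. (X n has_derivative L) (at z) \<and> (\<forall>c v. L (c *s v) = c * L v)"
      using X by (simp add: sb_space_iff sb_holomorphic_def)
    then obtain L where L: "\<And>n z. (X n has_derivative L n z) (at z)"
      and Lc: "\<And>n z c v. L n z (c *s v) = c * L n z v" by metis
    \<comment> \<open>One constant for both purposes: derivatives at points of norm at most
      \<open>R\<close> need the radius \<open>R + 1\<close>, and values there obey the same, weaker
      bound.\<close>
    define B where "B R m n = sqrt (exp (real k * (R + 1)\<^sup>2) * d m n)" for R m n
    have XB: "cmod (X m z - X n z) \<le> B (norm z) m n" for m n z
    proof -
      have "(norm z)\<^sup>2 \<le> (norm z + 1)\<^sup>2" by (intro power_mono) auto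
      then have "exp (real k * (norm z)\<^sup>2) * d m n \<le> exp (real k * (norm z + 1)\<^sup>2) * d m n"
        using ip_nonneg[OF DV] unfolding d_def by (intro mult_right_mono) (auto intro: mult_left_mono)
      with sb_pointwise_bound[OF DV k, of m z n] show ?thesis
        unfolding B_def d_def by (intro real_le_rsqrt) linarith
    qed
    have LB: "cmod (L m z v - L n z v) \<le> B R m n * norm v" if "norm z \<le> R" for R m n z v
      unfolding B_def d_def
      by (rule sb_derivative_bound[OF DV k that, of m n "\<lambda>v. L m z v - L n z v"])
        (auto intro!: has_derivative_diff L simp: Lc algebra_simps)
    have BC: "\<exists>N. \<forall>m\<ge>N. \<forall>n\<ge>N. B R m n < \<delta>" if "\<delta> > 0" for \<delta> R
    proof -
      have "0 < \<delta>\<^sup>2 / exp (real k * (R + 1)\<^sup>2)" using that by simp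
      from C[OF this] obtain N where N: "\<forall>m\<ge>N. \<forall>n\<ge>N. d m n < \<delta>\<^sup>2 / exp (real k * (R + 1)\<^sup>2)" by blast
      have "B R m n < \<delta>" if "m \<ge> N" "n \<ge> N" for m n
        unfolding B_def using N[rule_format, OF that] \<open>\<delta> > 0\<close>
        by (intro real_less_lsqrt) (auto simp: field_simps)
      then show ?thesis by blast
    qed
    have "Cauchy (\<lambda>n. L n z v)" for z v
    proof (rule metric_CauchyI)
      fix e :: real assume e: "0 < e"
      then have "0 < e / (norm v + 1)" by (intro divide_pos_pos add_nonneg_pos) auto
      from BC[OF this, of "norm z"] obtain N where N: "\<forall>m\<ge>N. \<forall>n\<ge>N. B (norm z) m n < e / (norm v + 1)" by blast
      have "dist (L m z v) (L n z v) < e" if "m \<ge> N" "n \<ge> N" for m n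
      proof -
        have "cmod (L m z v - L n z v) \<le> B (norm z) m n * norm v" by (rule LB) simp
        also have "\<dots> \<le> e / (norm v + 1) * norm v"
          using N[rule_format, OF that] by (intro mult_right_mono) auto
        also have "\<dots> < e"
          using e add_nonneg_pos[OF norm_ge_zero zero_less_one, of v] by (simp add: pos_divide_less_eq algebra_simps)
        finally show ?thesis by (simp add: dist_norm)
      qed
      then show "\<exists>M. \<forall>m\<ge>M. \<forall>n\<ge>M. dist (L m z v) (L n z v) < e" by blast
    qed
    then obtain G where G: "\<And>z v. (\<lambda>n. L n z v) \<longlonglongrightarrow> G z v"
      unfolding Cauchy_convergent_iff convergent_def by metis
    have "Cauchy (\<lambda>n. X n z)" for z
    proof (rule metric_CauchyI)
      fix e :: real assume e: "0 < e"
      from BC[OF this, of "norm z"] obtain N where N: "\<forall>m\<ge>N. \<forall>n\<ge>N. B (norm z) m n < e" by blast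
      then show "\<exists>M. \<forall>m\<ge>M. \<forall>n\<ge>M. dist (X m z) (X n z) < e"
        unfolding dist_norm using XB by (meson le_less_trans)
    qed
    then obtain g where g: "\<And>z. (\<lambda>n. X n z) \<longlonglongrightarrow> g z"
      unfolding Cauchy_convergent_iff convergent_def by metis
    have Gc: "G z (c *s v) = c * G z v" for z c v
      by (rule LIMSEQ_unique[OF G]) (simp add: Lc tendsto_mult_left[OF G])
    \<comment> \<open>Letting \<open>m\<close> tend to infinity in \<open>LB\<close> makes the
      derivatives converge uniformly on balls, as termwise differentiation demands.\<close>
    have unif: "\<forall>\<^sub>F n in sequentially. \<forall>z\<in>ball 0 R. \<forall>v. norm (L n z v - G z v) \<le> \<delta> * norm v" if "\<delta> > 0" for \<delta> R
    proof -
      obtain N where N: "\<forall>m\<ge>N. \<forall>n\<ge>N. B R m n < \<delta>" using BC[OF \<open>\<delta> > 0\<close>] by blast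
      show ?thesis
      proof (rule eventually_sequentiallyI[of N], intro ballI allI)
        fix n z v assume n: "n \<ge> N" and z: "z \<in> ball (0::complex^'m) R"
        have "(\<lambda>m. norm (L n z v - L m z v)) \<longlonglongrightarrow> norm (L n z v - G z v)"
          by (intro tendsto_intros G)
        moreover have "\<forall>\<^sub>F m in sequentially. norm (L n z v - L m z v) \<le> \<delta> * norm v"
        proof (rule eventually_sequentiallyI[of N])
          fix m assume "m \<ge> N"
          have "norm (L n z v - L m z v) \<le> B R n m * norm v" using z by (intro LB) auto
          also have "\<dots> \<le> \<delta> * norm v" using N n \<open>m \<ge> N\<close> by (intro mult_right_mono) (auto intro: less_imp_le)
          finally show "norm (L n z v - L m z v) \<le> \<delta> * norm v" .
        qed
        ultimately show "norm (L n z v - G z v) \<le> \<delta> * norm v"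
          by (rule tendsto_upperbound) simp
      qed
    qed
    have "(g has_derivative G z0) (at z0)" for z0
    proof -
      \<comment> \<open>A convex open set containing \<open>z0\<close>: convexity allows termwise
        differentiation, and openness turns the derivative within the ball into one at
        \<open>z0\<close>.\<close>
      let ?S = "ball (0::complex^'m) (norm z0 + 1)"
      have z0: "z0 \<in> ?S" by simp
      have "\<exists>h. \<forall>x\<in>?S. (\<lambda>n. X n x) \<longlonglongrightarrow> h x \<and> (h has_derivative G x) (at x within ?S)"
        by (rule has_derivative_sequence[OF convex_ball _ unif z0 g]) (auto intro: has_derivative_at_withinI L)
      then obtain h where h: "\<And>x. x \<in> ?S \<Longrightarrow> (\<lambda>n. X n x) \<longlonglongrightarrow> h x"
        and hd: "\<And>x. x \<in> ?S \<Longrightarrow> (h has_derivative G x) (at x within ?S)" by blast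
      have "(h has_derivative G z0) (at z0)" using hd[OF z0] at_within_open[OF z0 open_ball] by simp
      moreover have "h x = g x" if "x \<in> ?S" for x by (rule LIMSEQ_unique[OF h[OF that] g])
      ultimately show ?thesis
        using has_derivative_transform_within_open[OF _ open_ball z0] by blast
    qed
    then have holg: "sb_holomorphic g" unfolding sb_holomorphic_def using Gc by blast
    have lim: "(\<lambda>z. X n z - g z) \<in> sb_space k \<and> Re (sb_inner k (\<lambda>z. X n z - g z) (\<lambda>z. X n z - g z)) \<le> \<epsilon>"
      if N: "\<forall>m\<ge>N. \<forall>n\<ge>N. d m n < \<epsilon>" and n: "n \<ge> N" for \<epsilon> N n
    proof -
      have hol: "sb_holomorphic (\<lambda>z. X n z - g z)"
        using sb_holomorphic_lin[OF _ holg, of "X n" 1 "-1"] X by (simp add: sb_space_iff)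
      have l: "(\<lambda>m. X n z - X m z) \<longlonglongrightarrow> X n z - g z" for z by (intro tendsto_intros g)
      have b: "Re (sb_inner k (\<lambda>z. X n z - X m z) (\<lambda>z. X n z - X m z)) \<le> \<epsilon>" if "m \<ge> N" for m
        using N n that unfolding d_def by (simp add: less_imp_le)
      show ?thesis
        using sb_space_Fatou[of k "\<lambda>m z. X n z - X m z", OF k DV hol l b] by blast
    qed
    obtain N1 where N1: "\<forall>m\<ge>N1. \<forall>n\<ge>N1. d m n < 1" using C[of 1] by auto
    \<comment> \<open>So far only differences with \<open>g\<close> are known to lie in the space;
      \<open>g\<close> is recovered from one of them.\<close>
    have "(\<lambda>z. X N1 z - (X N1 z - g z)) \<in> sb_space k"
      by (rule diff_mem[OF X conjunct1[OF lim[OF N1 order.refl]]])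
    then have gV: "g \<in> sb_space k" by simp
    show "\<exists>g\<in>sb_space k. (\<lambda>n. Re (sb_inner k (\<lambda>z. X n z - g z) (\<lambda>z. X n z - g z))) \<longlonglongrightarrow> 0"
    proof (rule bexI[OF _ gV], rule LIMSEQ_I)
      fix r :: real assume "0 < r"
      then obtain N where N: "\<forall>m\<ge>N. \<forall>n\<ge>N. d m n < r / 2" using C[of "r / 2"] by auto
      have "norm (Re (sb_inner k (\<lambda>z. X n z - g z) (\<lambda>z. X n z - g z)) - 0) < r" if "n \<ge> N" for n
        using lim[OF N that] ip_nonneg[of "\<lambda>z. X n z - g z"] \<open>0 < r\<close> by auto
      then show "\<exists>no. \<forall>n\<ge>no. norm (Re (sb_inner k (\<lambda>z. X n z - g z) (\<lambda>z. X n z - g z)) - 0) < r" by blast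
    qed
  qed
qed

section \<open>Tensors as functions of a pair of points\<close>

text \<open>The inverse of the pair \<open>vec_fst\<close>, \<open>vec_snd\<close>. It matches up
  coordinates, hence carries the product of two Lebesgue measures to Lebesgue measure.\<close>

definition vec_join :: "(complex^'n) \<times> (complex^'n) \<Rightarrow> complex^('n + 'n)" where
  "vec_join p = (\<chi> s. case s of Inl i \<Rightarrow> fst p $ i | Inr i \<Rightarrow> snd p $ i)"

lemma vec_join_nth [simp]: "vec_join p $ Inl i = fst p $ i" "vec_join p $ Inr i = snd p $ i"
  by (simp_all add: vec_join_def)

lemma vec_fst_join [simp]: "vec_fst (vec_join p) = fst p" "vec_snd (vec_join p) = snd p"
  by (simp_all add: vec_fst_def vec_snd_def)

lemma vec_eq_sum_iff: "x = y \<longleftrightarrow> (\<forall>i. x $ Inl i = y $ Inl i) \<and> (\<forall>i. x $ Inr i = y $ Inr i)"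
  for x y :: "'a^('n::finite + 'n)"
  by (metis sumE vec_eq_iff)

lemma vec_join_axis: "vec_join (axis i c, 0) = axis (Inl i) c" "vec_join (0, axis i c) = axis (Inr i) c"
  by (auto simp: vec_eq_sum_iff axis_def)

lemma norm_vec_join: "(norm (vec_join p))\<^sup>2 = (norm (fst p))\<^sup>2 + (norm (snd p))\<^sup>2"
proof -
  have "(\<Sum>s\<in>UNIV. (cmod (vec_join p $ s))\<^sup>2) = (\<Sum>i\<in>UNIV. (cmod (fst p $ i))\<^sup>2) + (\<Sum>i\<in>UNIV. (cmod (snd p $ i))\<^sup>2)"
    by (simp flip: UNIV_Plus_UNIV add: sum.Plus)
  then show ?thesis by (simp add: norm_vec_def L2_set_def sum_nonneg)
qed

lemma exp_norm_vec_join: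
  "exp (- real k * (norm (vec_join p))\<^sup>2) = exp (- real k * (norm (fst p))\<^sup>2) * exp (- real k * (norm (snd p))\<^sup>2)"
  by (simp add: norm_vec_join algebra_simps flip: exp_add)

lemma distr_lborel_vec_join: "distr lborel borel vec_join = (lborel :: (complex^('n::finite + 'n)) measure)"
proof (rule distr_lborel_Basis_bij)
  show "linear vec_join" by (rule linearI) (auto simp: vec_eq_sum_iff)
  show "bij_betw (vec_join :: _ \<Rightarrow> complex^('n + 'n)) Basis Basis"
    unfolding bij_betw_def
  proof
    show "inj_on (vec_join :: _ \<Rightarrow> complex^('n + 'n)) Basis"
      by (rule inj_onI) (metis vec_fst_join prod.expand)
    have "vec_join ` Basis = (\<Union>i. \<Union>c\<in>Basis. {axis (Inl i) c}) \<union> (\<Union>i. \<Union>c\<in>Basis. {axis (Inr i) c :: complex^('n + 'n)})"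
      unfolding Basis_prod_def image_Un image_image Basis_vec_def
      by (simp add: image_UN vec_join_axis)
    also have "\<dots> = Basis"
    proof (intro subset_antisym subsetI)
      fix x :: "complex^('n + 'n)" assume "x \<in> Basis"
      then obtain s c where "x = axis s c" "c \<in> Basis" by (auto simp: Basis_vec_def)
      then show "x \<in> (\<Union>i. \<Union>c\<in>Basis. {axis (Inl i) c}) \<union> (\<Union>i. \<Union>c\<in>Basis. {axis (Inr i) c})"
        by (cases s) auto
    qed (auto simp: Basis_vec_def)
    finally show "vec_join ` Basis = (Basis :: (complex^('n + 'n)) set)" .
  qed
qed

lemma vec_join_measurable: "vec_join \<in> borel_measurable borel"
  by (rule linear_borel_measurable, rule linearI) (auto simp: vec_eq_sum_iff)

lemma vec_join_integral_mult:
  fixes f g :: "complex^'n \<Rightarrow> 'c::{real_normed_field,banach,second_countable_topology}"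
    and F :: "complex^('n + 'n) \<Rightarrow> 'c"
  assumes f: "integrable lborel f" and g: "integrable lborel g"
    and F: "F \<in> borel_measurable borel" "\<And>p. F (vec_join p) = f (fst p) * g (snd p)"
  shows "integrable lborel F" and "integral\<^sup>L lborel F = integral\<^sup>L lborel f * integral\<^sup>L lborel g"
proof -
  have m: "(vec_join :: _ \<Rightarrow> complex^('n + 'n)) \<in> borel_measurable borel" by (rule vec_join_measurable)
  have psf: "pair_sigma_finite (lborel :: (complex^'n) measure) (lborel :: (complex^'n) measure)" ..
  have i: "integrable lborel (\<lambda>p. F (vec_join p))"
    unfolding F(2) lborel_prod[symmetric] by (rule pair_integral_mult(1)[OF psf f g])
  show "integrable lborel F"
    using integrable_distr_eq[of vec_join lborel borel F] m F(1) i by (simp add: distr_lborel_vec_join)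
  have "integral\<^sup>L lborel F = (LINT p|lborel. F (vec_join p))"
    using integral_distr[of vec_join lborel borel F] m F(1) by (simp add: distr_lborel_vec_join)
  also have "\<dots> = integral\<^sup>L lborel f * integral\<^sup>L lborel g"
    unfolding F(2) lborel_prod[symmetric] by (rule pair_integral_mult(2)[OF psf f g])
  finally show "integral\<^sup>L lborel F = integral\<^sup>L lborel f * integral\<^sup>L lborel g" .
qed

lemma tensor_holomorphic:
  assumes "sb_holomorphic f" "sb_holomorphic g"
  shows "sb_holomorphic (tensor f g)"
proof -
  have "sb_holomorphic (\<lambda>v. f (vec_fst v + 0))"
    by (rule sb_holomorphic_compose_affine[OF assms(1)]) (auto intro!: linearI simp: vec_fst_def vec_eq_iff)
  moreover have "sb_holomorphic (\<lambda>v. g (vec_snd v + 0))"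
    by (rule sb_holomorphic_compose_affine[OF assms(2)]) (auto intro!: linearI simp: vec_snd_def vec_eq_iff)
  ultimately show ?thesis unfolding tensor_def by (simp add: sb_holomorphic_mult)
qed

lemma tensor_in_sb_space:
  assumes f: "f \<in> sb_space k" and g: "g \<in> sb_space k"
  shows "tensor f g \<in> sb_space k"
proof -
  have h: "sb_holomorphic (tensor f g)" using f g by (intro tensor_holomorphic) (auto simp: sb_space_iff)
  have [measurable]: "tensor f g \<in> borel_measurable borel" by (rule sb_holomorphic_measurable[OF h])
  have "integrable lborel (\<lambda>z. (cmod (tensor f g z))\<^sup>2 * exp (- real k * (norm z)\<^sup>2))"
  proof (rule vec_join_integral_mult(1))
    show "integrable lborel (\<lambda>z. (cmod (f z))\<^sup>2 * exp (- real k * (norm z)\<^sup>2))"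
      "integrable lborel (\<lambda>z. (cmod (g z))\<^sup>2 * exp (- real k * (norm z)\<^sup>2))"
      using f g by (auto simp: sb_space_iff)
    show "(cmod (tensor f g (vec_join p)))\<^sup>2 * exp (- real k * (norm (vec_join p))\<^sup>2) =
       (cmod (f (fst p)))\<^sup>2 * exp (- real k * (norm (fst p))\<^sup>2) * ((cmod (g (snd p)))\<^sup>2 * exp (- real k * (norm (snd p))\<^sup>2))" for p
      unfolding exp_norm_vec_join by (simp add: tensor_def norm_mult power_mult_distrib)
  qed measurable
  then show ?thesis using h by (simp add: sb_space_iff)
qed

text \<open>Weight and normalising constant both factor over the two points. This is the identity
  that makes functions of a pair a model of the Hilbert space tensor product.\<close>

lemma sb_inner_tensor:
  fixes x y a b :: "complex^'n \<Rightarrow> complex"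
  assumes x: "x \<in> sb_space k" and y: "y \<in> sb_space k" and a: "a \<in> sb_space k" and b: "b \<in> sb_space k"
  shows "sb_inner k (tensor x y) (tensor a b) = sb_inner k x a * sb_inner k y b"
proof -
  let ?G = "\<lambda>z. complex_of_real (exp (- real k * (norm z)\<^sup>2))"
  have "(LINT z|lborel. tensor x y z * cnj (tensor a b z) * ?G z)
     = (LINT z|lborel. x z * cnj (a z) * ?G z) * (LINT z|lborel. y z * cnj (b z) * ?G z)"
  proof (rule vec_join_integral_mult(2)[OF sb_integrable[OF x a] sb_integrable[OF y b]])
    show "(\<lambda>z. tensor x y z * cnj (tensor a b z) * ?G z) \<in> borel_measurable borel"
      using sb_integrable[OF tensor_in_sb_space[OF x y] tensor_in_sb_space[OF a b]]
      by (auto dest: borel_measurable_integrable)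
    show "tensor x y (vec_join p) * cnj (tensor a b (vec_join p)) * ?G (vec_join p) =
      x (fst p) * cnj (a (fst p)) * ?G (fst p) * (y (snd p) * cnj (b (snd p)) * ?G (snd p))" for p
      unfolding exp_norm_vec_join by (simp add: tensor_def)
  qed
  then show ?thesis unfolding sb_inner_def by (simp add: power_add)
qed

section \<open>Entropy of the superposition of two coherent states\<close>

text \<open>Squaring (1 - s) N \<le> 2 - 2 s^2 \<le> 2 bounds 1 / N^2 below by (1 - s)^2 / 4. This
  supplies the second pair of factors in the exponent four.\<close>

lemma purity_bound:
  fixes s N :: real
  assumes s: "0 \<le> s" "s \<le> 1" and N: "0 < N" "N \<le> 2 + 2 * s"
  shows "(1/2) * (1 - s) ^ 4 \<le> 2 * (1 - s)\<^sup>2 / N\<^sup>2"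
proof -
  have "(1 - s) * N \<le> (1 - s) * (2 + 2 * s)" using s N by (intro mult_left_mono) auto
  also have "\<dots> = 2 - 2 * s\<^sup>2" by (simp add: algebra_simps power2_eq_square)
  also have "\<dots> \<le> 2" by simp
  finally have "((1 - s) * N)\<^sup>2 \<le> 2\<^sup>2" using s N by (intro power_mono) auto
  then have "(1 - s)\<^sup>2 * ((1 - s) * N)\<^sup>2 \<le> (1 - s)\<^sup>2 * 4" by (intro mult_left_mono) auto
  then show ?thesis using N by (simp add: field_simps power2_eq_square power4_eq_xxxx)
qed

section \<open>Coherent states and the reduced state of their superposition\<close>

lemma sb_inner_theta:
  assumes k: "k > 0"
  shows "sb_inner k (theta k p) (theta k q) = exp (of_nat k * herm q p)"
  using sb_reproducing[OF theta_in_sb_space[OF k] k] by (simp add: theta_eq)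

lemma sb_norm_theta:
  assumes k: "k > 0"
  shows "(sb_norm k (theta k p))\<^sup>2 = exp (real k * (norm p)\<^sup>2)"
proof -
  have "sb_inner k (theta k p) (theta k p) = of_real (exp (real k * (norm p)\<^sup>2))"
    unfolding sb_inner_theta[OF k] herm_self of_real_exp_mult ..
  then show ?thesis by (simp add: sb_norm_def)
qed

definition coherent :: "nat \<Rightarrow> complex^'n \<Rightarrow> complex^'n \<Rightarrow> complex" where
  "coherent k p = (\<lambda>z. of_real (1 / sb_norm k (theta k p)) * theta k p z)"

context
  fixes k :: nat and p q :: "complex^'n"
  assumes k: "k > 0"
begin

interpretation H: hilbert_fun_space "sb_space k :: (complex^'n \<Rightarrow> complex) set" "sb_inner k"
  by (rule sb_hilbert_fun_space[OF k])

interpretation HH: inner_fun_space "sb_space k :: (complex^('n + 'n) \<Rightarrow> complex) set" "sb_inner k"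
  by (rule sb_inner_fun_space[OF k])

lemma coherent_in_sb_space: "coherent k a \<in> sb_space k" for a :: "complex^'n"
  unfolding coherent_def by (intro H.scale_mem theta_in_sb_space[OF k])

lemma sb_inner_coherent:
  "sb_inner k (coherent k a) (coherent k b)
    = exp (of_nat k * herm b a) / of_real (sb_norm k (theta k a) * sb_norm k (theta k b))" for a b :: "complex^'n"
  unfolding coherent_def
  by (subst H.ip_scale, (intro theta_in_sb_space H.scale_mem k)+, subst H.ip_scale_right)
    (simp_all add: theta_in_sb_space sb_inner_theta k)

lemma sb_inner_coherent_self: "sb_inner k (coherent k a) (coherent k a) = 1" for a :: "complex^'n"
proof -
  have "exp (of_nat k * herm a a) = complex_of_real ((sb_norm k (theta k a))\<^sup>2)"
    unfolding herm_self sb_norm_theta[OF k] of_real_exp_mult ..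
  moreover have "sb_norm k (theta k a) \<noteq> 0" using sb_norm_theta[OF k, of a] by auto
  ultimately show ?thesis unfolding sb_inner_coherent by (simp add: power2_eq_square)
qed

lemma cmod_sb_inner_coherent:
  "(cmod (sb_inner k (coherent k p) (coherent k q)))\<^sup>2 = exp (- real k * (norm (p - q))\<^sup>2)"
proof -
  have "cmod (exp (of_nat k * herm q p)) = exp (real k * Re (herm q p))"
    by (simp add: norm_exp_eq_Re)
  then have "(cmod (sb_inner k (coherent k p) (coherent k q)))\<^sup>2
      = (exp (real k * Re (herm q p)))\<^sup>2 / (exp (real k * (norm p)\<^sup>2) * exp (real k * (norm q)\<^sup>2))"
    unfolding sb_inner_coherent norm_divide power_divide
    by (simp add: norm_mult power_mult_distrib sb_norm_theta[OF k])
  also have "\<dots> = exp (2 * (real k * Re (herm q p)) - (real k * (norm p)\<^sup>2 + real k * (norm q)\<^sup>2))"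
    by (simp add: exp_diff exp_add exp_double)
  also have "2 * (real k * Re (herm q p)) - (real k * (norm p)\<^sup>2 + real k * (norm q)\<^sup>2) = - real k * (norm (p - q))\<^sup>2"
  proof -
    have "(norm (p - q))\<^sup>2 = (norm q)\<^sup>2 + (norm p)\<^sup>2 - 2 * Re (herm q p)"
      using norm_add_square[of q "- p"] by (simp add: herm_minus_right norm_minus_commute)
    then show ?thesis by (simp only: right_diff_distrib mult_minus_left distrib_left)
  qed
  finally show ?thesis .
qed

text \<open>The coefficient, an inverse squared norm, is shared evenly between the two tensor
  factors, which normalises each of them.\<close>

lemma w_state_eq:
  "w_state k p q = (\<lambda>x. 1 * tensor (coherent k p) (coherent k p) x + 1 * tensor (coherent k q) (coherent k q) x)"
  by (simp add: w_state_def tensor_def coherent_def power2_eq_square fun_eq_iff)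

abbreviation overlap :: complex where
  "overlap \<equiv> sb_inner k (coherent k p) (coherent k q)"

definition w_norm2 :: real where
  "w_norm2 = 2 + 2 * Re (overlap\<^sup>2)"

lemma w_state_in_sb_space: "w_state k p q \<in> sb_space k"
  unfolding w_state_eq by (intro HH.lin_mem tensor_in_sb_space coherent_in_sb_space)

lemma sb_inner_tensor_w_state:
  assumes "x \<in> sb_space k" "y \<in> sb_space k"
  shows "sb_inner k (tensor x y) (w_state k p q)
    = sb_inner k x (coherent k p) * sb_inner k y (coherent k p) + sb_inner k x (coherent k q) * sb_inner k y (coherent k q)"
  unfolding w_state_eq
  by (subst HH.ip_lin_right) (simp_all add: tensor_in_sb_space coherent_in_sb_space assms sb_inner_tensor)

lemma sb_norm_w_state: "sb_norm k (w_state k p q) = sqrt w_norm2"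
proof -
  have c: "sb_inner k (coherent k q) (coherent k p) = cnj overlap"
    by (rule H.ip_cnj[symmetric]) (rule coherent_in_sb_space)+
  have "sb_inner k (w_state k p q) (w_state k p q)
     = sb_inner k (tensor (coherent k p) (coherent k p)) (w_state k p q) + sb_inner k (tensor (coherent k q) (coherent k q)) (w_state k p q)"
    by (subst (1) w_state_eq, subst HH.ip_lin) (simp_all add: tensor_in_sb_space coherent_in_sb_space w_state_in_sb_space)
  also have "\<dots> = 2 + (overlap\<^sup>2 + cnj (overlap\<^sup>2))"
    by (simp add: sb_inner_tensor_w_state coherent_in_sb_space sb_inner_coherent_self c power2_eq_square)
  also have "\<dots> = of_real w_norm2" unfolding complex_add_cnj w_norm2_def by simp
  finally show ?thesis by (simp add: sb_norm_def)
qed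

text \<open>The two summands could cancel only if the squared overlap were -1. Its modulus is below
  1 for distinct points, and the overlap is 1 for equal ones.\<close>

lemma w_norm2_pos: "0 < w_norm2"
proof (cases "p = q")
  case True
  then show ?thesis unfolding w_norm2_def by (simp add: sb_inner_coherent_self)
next
  case False
  have "\<bar>Re (overlap\<^sup>2)\<bar> \<le> (cmod overlap)\<^sup>2" using abs_Re_le_cmod[of "overlap\<^sup>2"] by (simp add: norm_power)
  also have "\<dots> < 1" using k False unfolding cmod_sb_inner_coherent by simp
  finally show ?thesis by (simp add: w_norm2_def)
qed

text \<open>Each summand is a combination of products such as
  \<open>ip u (e i) * ip (e i) v\<close>, which Parseval's identity sums to \<open>ip u v\<close>.
  The partial trace is therefore the same for every basis \<open>e\<close>.\<close>

lemma ptrace_form_b_state: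
  assumes e: "H.orthonormal_basis e" and x: "x \<in> sb_space k" and y: "y \<in> sb_space k"
  shows "ptrace_form k e (b_state k p q) x y = H.pair_form (coherent k p) (coherent k q) x y / of_real w_norm2"
proof -
  define u v where "u = coherent k p" and "v = coherent k q"
  have u: "u \<in> sb_space k" and v: "v \<in> sb_space k" by (simp_all add: u_def v_def coherent_in_sb_space)
  have eV: "e i \<in> sb_space k" for i using e by (simp add: H.orthonormal_basis_def)
  define N where "N = w_norm2"
  have N: "N > 0" unfolding N_def by (rule w_norm2_pos)
  have b_eq: "b_state k p q = (\<lambda>z. of_real (1 / sqrt N) * w_state k p q z)"
    by (simp add: b_state_def sb_norm_w_state N_def)
  have bV: "b_state k p q \<in> sb_space k" unfolding b_eq by (rule HH.scale_mem[OF w_state_in_sb_space])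
  have tb: "sb_inner k (tensor a (e i)) (b_state k p q)
      = (sb_inner k a u * sb_inner k (e i) u + sb_inner k a v * sb_inner k (e i) v) / of_real (sqrt N)"
    if a: "a \<in> sb_space k" for a i
    unfolding b_eq
    by (subst HH.ip_scale_right[OF w_state_in_sb_space tensor_in_sb_space[OF a eV]])
      (simp add: sb_inner_tensor_w_state[OF a eV] u_def v_def)
  have cu: "cnj (sb_inner k a b) = sb_inner k b a" if "a \<in> sb_space k" "b \<in> sb_space k" for a b :: "complex^'n \<Rightarrow> complex"
    by (rule H.ip_cnj[OF that])
  have sN: "complex_of_real (sqrt N) * complex_of_real (sqrt N) = of_real N"
    using N by (simp flip: of_real_mult)
  have summand: "sb_inner k (tensor x (e i)) (proj_line k (b_state k p q) (tensor y (e i))) =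
     (1 / of_real N) * (sb_inner k x u * sb_inner k u y * (sb_inner k u (e i) * sb_inner k (e i) u)
      + sb_inner k x v * sb_inner k v y * (sb_inner k v (e i) * sb_inner k (e i) v)
      + sb_inner k x u * sb_inner k v y * (sb_inner k v (e i) * sb_inner k (e i) u)
      + sb_inner k x v * sb_inner k u y * (sb_inner k u (e i) * sb_inner k (e i) v))" for i
  proof -
    have "sb_inner k (tensor x (e i)) (proj_line k (b_state k p q) (tensor y (e i)))
      = cnj (sb_inner k (tensor y (e i)) (b_state k p q)) * sb_inner k (tensor x (e i)) (b_state k p q)"
      unfolding proj_line_def by (rule HH.ip_scale_right[OF bV tensor_in_sb_space[OF x eV]])
    also have "\<dots> = (sb_inner k u y * sb_inner k u (e i) + sb_inner k v y * sb_inner k v (e i)) *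
        (sb_inner k x u * sb_inner k (e i) u + sb_inner k x v * sb_inner k (e i) v) / (complex_of_real (sqrt N) * complex_of_real (sqrt N))"
      unfolding tb[OF x] tb[OF y] by (simp add: cu u v x y eV)
    finally show ?thesis unfolding sN by (simp add: algebra_simps add_divide_distrib)
  qed
  have "((\<lambda>i. sb_inner k (tensor x (e i)) (proj_line k (b_state k p q) (tensor y (e i)))) has_sum
     (1 / of_real N) * (sb_inner k x u * sb_inner k u y * sb_inner k u u
      + sb_inner k x v * sb_inner k v y * sb_inner k v v
      + sb_inner k x u * sb_inner k v y * sb_inner k v u
      + sb_inner k x v * sb_inner k u y * sb_inner k u v)) UNIV"
    unfolding summand by (intro has_sum_cmult_right has_sum_add H.Parseval[OF e] u v)
  then have "ptrace_form k e (b_state k p q) x y = (1 / of_real N) * (sb_inner k x u * sb_inner k u y * sb_inner k u u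
      + sb_inner k x v * sb_inner k v y * sb_inner k v v
      + sb_inner k x u * sb_inner k v y * sb_inner k v u
      + sb_inner k x v * sb_inner k u y * sb_inner k u v)"
    unfolding ptrace_form_def by (rule infsumI)
  also have "\<dots> = H.pair_form u v x y / of_real N"
    using sb_inner_coherent_self by (simp add: H.pair_form_def u_def v_def algebra_simps add_divide_distrib)
  finally show ?thesis by (simp add: u_def v_def N_def)
qed

lemma sb_onb_iff: "sb_onb k e \<longleftrightarrow> H.orthonormal_basis e"
  by (simp add: sb_onb_def H.orthonormal_basis_def)

text \<open>Keeps the entropy bound, which is stated for every eigenbasis, from being
  vacuous.\<close>

lemma b_state_eigenbasis:
  assumes e: "sb_onb k e"
  shows "\<exists>f l. eigen_onb k (ptrace_form k e (b_state k p q)) f l"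
proof -
  have e': "H.orthonormal_basis e" using e by (simp add: sb_onb_iff)
  obtain f l where f: "H.orthonormal_basis f"
    and l: "\<And>j x. x \<in> sb_space k \<Longrightarrow> H.pair_form (coherent k p) (coherent k q) x (f j) = of_real (l j) * sb_inner k x (f j)"
    using H.pair_form_eigenbasis[OF coherent_in_sb_space coherent_in_sb_space e' sb_inner_coherent_self] by blast
  have fV: "f j \<in> sb_space k" for j using f by (simp add: H.orthonormal_basis_def)
  have "eigen_onb k (ptrace_form k e (b_state k p q)) f (\<lambda>j. l j / w_norm2)"
    unfolding eigen_onb_def using f by (simp add: sb_onb_iff ptrace_form_b_state[OF e' _ fV] l)
  then show ?thesis by blast
qed

lemma b_state_entropy:
  assumes e: "sb_onb k e" and f: "eigen_onb k (ptrace_form k e (b_state k p q)) f l"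
  shows "(1/2) * (1 - exp (- real k * (norm (p - q))\<^sup>2)) ^ 4 \<le> entropy_of_eigenvalues l"
proof -
  have e': "H.orthonormal_basis e" using e by (simp add: sb_onb_iff)
  have f': "H.orthonormal_basis f" using f by (simp add: sb_onb_iff eigen_onb_def)
  have fV: "f j \<in> sb_space k" for j using f' by (simp add: H.orthonormal_basis_def)
  define N where "N = w_norm2"
  define s where "s = (cmod overlap)\<^sup>2"
  have N: "N > 0" unfolding N_def by (rule w_norm2_pos)
  \<comment> \<open>Undoes the normalisation: the trace and purity formulas are about
    \<open>pair_form\<close>, whose eigenvalues are \<open>N * l j\<close>.\<close>
  have eig: "H.pair_form (coherent k p) (coherent k q) x (f j) = of_real (N * l j) * sb_inner k x (f j)" if "x \<in> sb_space k" for j x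
  proof -
    have "H.pair_form (coherent k p) (coherent k q) x (f j) / of_real N = of_real (l j) * sb_inner k x (f j)"
      using f that unfolding eigen_onb_def N_def by (simp add: ptrace_form_b_state[OF e' that fV, symmetric])
    then show ?thesis using N by (simp add: field_simps)
  qed
  note ev = H.pair_form_eigenvalues[OF coherent_in_sb_space coherent_in_sb_space
      sb_inner_coherent_self sb_inner_coherent_self f' eig, folded w_norm2_def, folded N_def s_def]
  have "1 - (1 - 2 * (1 - s)\<^sup>2 / N\<^sup>2) \<le> entropy_of_eigenvalues l"
  proof (rule entropy_ge_linear_entropy)
    show "0 \<le> l j" for j using ev(1)[of j] N by (simp add: zero_le_mult_iff)
    show "finite {j. l j \<noteq> 0}" using ev(2) N by simp
    show "(l has_sum 1) UNIV" using has_sum_cmult_right[OF ev(3), of "1 / N"] N by simp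
    have "((\<lambda>j. 1 / N\<^sup>2 * (N * l j)\<^sup>2) has_sum 1 / N\<^sup>2 * (N\<^sup>2 - 2 * (1 - s)\<^sup>2)) UNIV"
      by (rule has_sum_cmult_right[OF ev(4)])
    then show "((\<lambda>j. (l j)\<^sup>2) has_sum 1 - 2 * (1 - s)\<^sup>2 / N\<^sup>2) UNIV"
      using N by (simp add: power_mult_distrib diff_divide_distrib)
  qed
  moreover have "(1/2) * (1 - s) ^ 4 \<le> 2 * (1 - s)\<^sup>2 / N\<^sup>2"
  proof (rule purity_bound)
    show "0 \<le> s" by (simp add: s_def)
    show "s \<le> 1" unfolding s_def cmod_sb_inner_coherent by simp
    show "0 < N" by fact
    have "Re (overlap\<^sup>2) \<le> s" using complex_Re_le_cmod[of "overlap\<^sup>2"] by (simp add: s_def norm_power)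
    then show "N \<le> 2 + 2 * s" by (simp add: N_def w_norm2_def)
  qed
  ultimately show ?thesis unfolding s_def cmod_sb_inner_coherent by simp
qed

end

theorem theorem2:
  fixes p q :: "complex^'n"
  shows "\<forall>\<^sub>F k in sequentially.
    \<forall>e. sb_onb k e \<longrightarrow>
      (\<exists>f l. eigen_onb k (ptrace_form k e (b_state k p q)) f l) \<and>
      (\<forall>f l. eigen_onb k (ptrace_form k e (b_state k p q)) f l \<longrightarrow>
         entropy_of_eigenvalues l \<ge> (1/2) * (1 - exp (- real k * (norm (p - q))^2)) ^ 4)"
  \<comment> \<open>The bound holds from k = 1 on; at k = 0 the prefactor of \<open>sb_inner\<close>
    is zero and the form degenerates.\<close>
  using eventually_gt_at_top[of 0]
  by eventually_elim (use b_state_eigenbasis b_state_entropy in blast)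

end
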